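(* Let $c>0$ be a real number, let $k\ge 0$ and $n\ge k+4$ be integers, and let $G\in\mathcal{C}_n^k$. (A) Suppose $k=0$. Then, with $t\ge 0$ an integer, $$\prod\nolimits_{1,c}(G)\;\le\;\begin{cases}16^{c} & \text{if } n=4,\\ 2^{(3t+6)c} & \text{if } n=2t+5,\\ 2^{(3t+4)c}\,9^{c} & \text{if } n=2(t+3),\end{cases}$$ and equality holds if and only if the degree sequence of $G$ is, respectively: $2,2,2,2$; $\ \underbrace{4,\dots,4}_{t+1},\underbrace{2,\dots,2}_{t+4}$; $\ \underbrace{4,\dots,4}_{t},3,3,\underbrace{2,\dots,2}_{t+4}$. (B) Suppose $k\ne 0$ and $\prod_{1,c}(G)$ attains the maximal value of $\prod_{1,c}$ over $\mathcal{C}_n^k$. Then at least one of the following holds: (i) $|d(u)-d(v)|\le 1$ for any nonpendant vertices $u,v$ of $G$; (ii) $d(u)\in\{2,3,4\}$ for any nonpendant vertex $u$ of $G$, and moreover $G$ contains no cycle of length greater than $3$; no dense path of length greater than $1$, except for at most one dense path, of length $2$; and no path of length greater than $0$ connecting only two cycles, except for at most one such path, of length $1$.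
   Context: All graphs are finite, simple and connected. A cactus is a connected graph all of whose blocks are edges or cycles; equivalently, any two distinct cycles have at most one vertex in common (trees are cacti). A pendant vertex is a vertex of degree $1$; a nonpendant vertex is a vertex that is not pendant. For $n\ge k\ge 0$, $\mathcal{C}_n^k$ denotes the set of cactus graphs with $n$ vertices of which exactly $k$ are pendant vertices. For $c>0$ the first (generalized) multiplicative Zagreb index is $\prod_{1,c}(G)=\prod_{v\in V(G)}d(v)^c$, where $d(v)$ is the degree of $v$. Degree sequences are considered up to order. Dense path: for $r\ge 1$ and $p\ge 1$ let $P_1=u_1u_2\cdots u_pv_1,\ \dots,\ P_r=u_1u_2\cdots u_pv_r$ be paths of $G$ with $d(v_i)=1$ for all $i$, such that $P_i$ meets at most one cycle of $G$, and if it meets a cycle $C$ then $V(P_i)\cap V(C)=\{u_1\}$. The subgraph of $G$ induced by $\{v_i,u_j: 1\le i\le r,\ 1\le j\le p\}$ is called a dense path (for $r=1$, a pendant path); its length is the length (number of edges) $p$ of the paths $P_i$. Path connecting only two cycles: a path $P=x_1x_2\cdots x_q$ of $G$ for which there are two distinct cycles $C,C'$ of $G$ with $V(P)\cap V(C)=\{x_1\}$ and $V(P)\cap V(C')=\{x_q\}$, and such that $P$ has no vertex in common with any cycle of $G$ other than $C$ and $C'$. Its length is its number of edges $q-1$. *)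

theory Defs
  imports Complex_Main "HOL-Library.Multiset" "Graph_Theory.Graph_Theory"
begin

text \<open>
  A finite simple graph is a \<^const>\<open>pair_graph\<close>: every undirected edge \<open>uv\<close> is represented by the
  two arcs \<open>(u, v)\<close> and \<open>(v, u)\<close>, so the out-degree of a vertex is its degree.
  \<open>Digraph_Component.connected\<close> includes nonemptiness; the name is qualified because
  \<^theory>\<open>Complex_Main\<close> has a topological constant of the same name.
\<close>

abbreviation degree :: "'a pair_pre_digraph \<Rightarrow> 'a \<Rightarrow> nat" where
  "degree G v \<equiv> out_degree (with_proj G) v"

definition nonpendant :: "'a pair_pre_digraph \<Rightarrow> 'a set" where
  "nonpendant G = {v \<in> pverts G. degree G v \<noteq> 1}"

text \<open>
  Cycles are treated as subgraphs, so that the rotations and the reversal of a closed walk count as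
  one and the same cycle. The library's closed arc walks include \<open>u v u\<close>, which runs back and forth
  along one undirected edge; requiring length at least 3 excludes precisely these.
\<close>

definition cycles :: "'a pair_pre_digraph \<Rightarrow> 'a pair_pre_digraph set" where
  "cycles G = {\<lparr>pverts = fst ` set p, parcs = set p \<union> (set p)\<inverse>\<rparr> | p.
     pre_digraph.cycle (with_proj G) p \<and> 3 \<le> length p}"

text \<open>
  Nonseparable: connected and without cut vertex. The guard \<open>verts H \<noteq> {v}\<close> is needed because the
  graph without vertices is not connected in the sense of the library.
\<close>

definition nonseparable :: "('a, 'b) pre_digraph \<Rightarrow> bool" where
  "nonseparable H \<longleftrightarrow> graph H \<and> Digraph_Component.connected H \<and>
     (\<forall>v \<in> verts H. verts H \<noteq> {v} \<longrightarrow> Digraph_Component.connected (pre_digraph.del_vert H v))"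

definition block :: "'a pair_pre_digraph \<Rightarrow> 'a pair_pre_digraph \<Rightarrow> bool" where
  "block G B \<longleftrightarrow> pre_digraph.max_subgraph (with_proj G) nonseparable (with_proj B)"

definition cactus :: "'a pair_pre_digraph \<Rightarrow> bool" where
  "cactus G \<longleftrightarrow> pair_graph G \<and> Digraph_Component.connected (with_proj G) \<and>
     (\<forall>B. block G B \<longrightarrow>
        (\<exists>u v. u \<noteq> v \<and> B = \<lparr>pverts = {u, v}, parcs = {(u, v), (v, u)}\<rparr>) \<or> B \<in> cycles G)"

definition cacti :: "nat \<Rightarrow> nat \<Rightarrow> 'a pair_pre_digraph set" where
  "cacti n k = {G. cactus G \<and> card (pverts G) = n \<and> card {v \<in> pverts G. degree G v = 1} = k}"

definition zagreb1 :: "real \<Rightarrow> 'a pair_pre_digraph \<Rightarrow> real" where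
  "zagreb1 c G = (\<Prod>v \<in> pverts G. real (degree G v) powr c)"

definition degree_sequence :: "'a pair_pre_digraph \<Rightarrow> nat multiset" where
  "degree_sequence G = image_mset (degree G) (mset_set (pverts G))"

text \<open>
  \<open>dense_path G D p\<close>: the subgraph \<open>D\<close> of \<open>G\<close> is a dense path of length \<open>p\<close>. Here \<open>us\<close> is
  \<open>u\<^sub>1, \<dots>, u\<^sub>p\<close> and \<open>W\<close> is \<open>{v\<^sub>1, \<dots>, v\<^sub>r}\<close>; \<open>W\<close> need not contain all pendant neighbours of \<open>u\<^sub>p\<close>.
\<close>

definition dense_path :: "'a pair_pre_digraph \<Rightarrow> ('a, 'a \<times> 'a) pre_digraph \<Rightarrow> nat \<Rightarrow> bool" where
  "dense_path G D p \<longleftrightarrow> (\<exists>us W. 1 \<le> p \<and> length us = p \<and> W \<noteq> {} \<and>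
     (\<forall>v \<in> W. vpath (us @ [v]) (with_proj G) \<and> degree G v = 1 \<and>
        (\<forall>C \<in> cycles G. \<forall>C' \<in> cycles G.
           set (us @ [v]) \<inter> pverts C \<noteq> {} \<and> set (us @ [v]) \<inter> pverts C' \<noteq> {} \<longrightarrow> C = C') \<and>
        (\<forall>C \<in> cycles G. set (us @ [v]) \<inter> pverts C \<noteq> {} \<longrightarrow>
           set (us @ [v]) \<inter> pverts C = {hd us})) \<and>
     D = with_proj G \<restriction> (set us \<union> W))"

text \<open>
  \<open>two_cycle_path G P l\<close>: the path \<open>P\<close>, taken as a subgraph so that a path and its reversal are not
  counted twice, has length \<open>l\<close> and connects only two cycles of \<open>G\<close>. A single vertex shared by
  two cycles is such a path of length 0.
\<close>

definition two_cycle_path :: "'a pair_pre_digraph \<Rightarrow> 'a pair_pre_digraph \<Rightarrow> nat \<Rightarrow> bool" where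
  "two_cycle_path G P l \<longleftrightarrow> (\<exists>xs C C'. vpath xs (with_proj G) \<and>
     C \<in> cycles G \<and> C' \<in> cycles G \<and> C \<noteq> C' \<and>
     set xs \<inter> pverts C = {hd xs} \<and> set xs \<inter> pverts C' = {last xs} \<and>
     (\<forall>C'' \<in> cycles G - {C, C'}. set xs \<inter> pverts C'' = {}) \<and>
     P = \<lparr>pverts = set xs, parcs = set (vwalk_arcs xs) \<union> (set (vwalk_arcs xs))\<inverse>\<rparr> \<and>
     l = vwalk_length xs)"

end

(*
  Let G have N nonpendant and k pendant vertices and r cycles. Two cycles sharing an edge have a
  nonseparable union, which lies in a block, so in a cactus they are equal. Hence a vertex on c cycles
  and e bridges has degree 2 c + e, and deleting an edge of each cycle leaves a spanning tree. Counting
  degrees gives N = 1 + 2 r + x + y, where x is the total excess of the cycle lengths over 3 and y is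
  the number of bridges between nonpendant vertices.

  Since 2 c + e \<le> 2^c (3/2)^e, with equality only for (c, e) = (1, 0), (1, 1), (2, 0), the product of
  the nonpendant degrees is at most 2^(3 r + x) (3/2)^(k + 2 y), and for given N this is largest for x = 0
  and y \<le> 1, depending on the parity of N. This settles the case k = 0. For k > 0, attach pendant edges
  one by one, always at a vertex of least nonpendant degree, to a cactus of triangles with y \<le> 1:
  either this attains the bound, and the equality case yields (ii), or it ends in degrees that differ by
  at most 1 and have the largest possible sum, and then every maximiser is balanced too.
*)

theory Submission
  imports Defs
begin

section \<open>Connectivity and cycles as vertex lists\<close>

text \<open>A bound through the degree sum alone cannot settle \<open>k = 0\<close>: it favours
  degrees close to each other, whereas a vertex of degree 3 needs a bridge, and each bridge between
  nonpendant vertices leaves less room for cycles. The weight therefore records how a degree is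
  composed. Being multiplicative, its product over the nonpendant vertices depends only on the
  numbers of cycle incidences and bridge ends. The bases 2 and 3/2 are forced by equality at (1, 0)
  and (1, 1), that is, at degrees 2 and 3; equality at (2, 0), degree 4, then comes for free.

  With many pendant edges these three types no longer suffice and the weight bound is not attained.
  The degree sum is then the only remaining constraint, and log-concavity takes over. Alternatives
  (i) and (ii) reflect these two regimes.

  Since the index sees only degrees, a competitor is fully described by its degree multiset. Fixing
  \<open>n\<close> and \<open>k\<close> fixes N, and the parity of N decides whether triangles alone
  can account for it or one inner bridge is left over.\<close>

definition conn :: "'a set \<Rightarrow> 'a rel \<Rightarrow> bool" where
  "conn V E \<longleftrightarrow> V \<noteq> {} \<and> (\<forall>u \<in> V. \<forall>v \<in> V. (u, v) \<in> (E \<inter> V \<times> V)\<^sup>*)"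

lemma conn_mono:
  assumes "conn V E" "E \<subseteq> E'"
  shows "conn V E'"
proof -
  have "(E \<inter> V \<times> V)\<^sup>* \<subseteq> (E' \<inter> V \<times> V)\<^sup>*" using assms(2) by (intro rtrancl_mono) auto
  then show ?thesis using assms(1) by (auto simp: conn_def)
qed

lemma conn_Un:
  assumes "conn V E" "conn W E" "V \<inter> W \<noteq> {}"
  shows "conn (V \<union> W) E"
proof -
  let ?R = "E \<inter> (V \<union> W) \<times> (V \<union> W)"
  have "(E \<inter> V \<times> V)\<^sup>* \<subseteq> ?R\<^sup>*" "(E \<inter> W \<times> W)\<^sup>* \<subseteq> ?R\<^sup>*" by (intro rtrancl_mono; auto)+
  then have *: "\<And>u v. u \<in> V \<Longrightarrow> v \<in> V \<Longrightarrow> (u, v) \<in> ?R\<^sup>*" "\<And>u v. u \<in> W \<Longrightarrow> v \<in> W \<Longrightarrow> (u, v) \<in> ?R\<^sup>*"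
    using assms(1,2) unfolding conn_def by blast+
  obtain z where z: "z \<in> V" "z \<in> W" using assms(3) by auto
  have "(u, z) \<in> ?R\<^sup>*" "(z, u) \<in> ?R\<^sup>*" if "u \<in> V \<union> W" for u
    using that * z by blast+
  then show ?thesis using z by (auto simp: conn_def intro: rtrancl_trans)
qed

lemma conn_Un_Un:
  assumes "conn V E" "conn W F" "V \<inter> W \<noteq> {}"
  shows "conn (V \<union> W) (E \<union> F)"
  using conn_Un[OF conn_mono[OF assms(1), of "E \<union> F"] conn_mono[OF assms(2), of "E \<union> F"] assms(3)]
  by simp

lemma conn_singleton: "conn {x} E"
  by (auto simp: conn_def)

lemma conn_pair: "(x, y) \<in> E \<Longrightarrow> (y, x) \<in> E \<Longrightarrow> conn {x, y} E"
  by (auto simp: conn_def)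

lemma conn_vwalk:
  "xs \<noteq> [] \<Longrightarrow> set (vwalk_arcs xs) \<subseteq> E \<Longrightarrow> sym E \<Longrightarrow> conn (set xs) E"
proof (induction xs rule: vwalk_arcs.induct)
  case (2 x)
  then show ?case by (simp add: conn_singleton)
next
  case (3 x y xs)
  have "conn ({x, y} \<union> set (y # xs)) E"
    using 3 by (intro conn_Un conn_pair) (auto dest: symD)
  then show ?case by (simp add: insert_commute)
qed simp

lemma conn_closed:
  assumes "conn V E" "x \<in> V" "x \<in> S" "\<And>u v. u \<in> S \<Longrightarrow> u \<in> V \<Longrightarrow> v \<in> V \<Longrightarrow> (u, v) \<in> E \<Longrightarrow> v \<in> S"
  shows "V \<subseteq> S"
proof
  fix y assume "y \<in> V"
  then have "(x, y) \<in> (E \<inter> V \<times> V)\<^sup>*" using assms(1,2) by (auto simp: conn_def)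
  then show "y \<in> S" by induction (use assms(3,4) in auto)
qed

text \<open>No step leads from \<open>A\<close> to \<open>B\<close>, so \<open>A\<close> is closed
  within \<open>V\<close>. This is applied to a nonseparable subgraph from which the gluing vertex
  has been removed.\<close>

lemma conn_separated:
  assumes "conn V E" "V \<subseteq> A \<union> B" "A \<inter> B = {}" "\<And>u v. u \<in> A \<Longrightarrow> v \<in> B \<Longrightarrow> (u, v) \<notin> E"
  shows "V \<inter> A = {} \<or> V \<subseteq> A"
proof (rule disjCI)
  assume "\<not> V \<subseteq> A"
  show "V \<inter> A = {}"
  proof (rule ccontr)
    assume "V \<inter> A \<noteq> {}"
    then obtain x where "x \<in> V" "x \<in> A" by auto
    then have "V \<subseteq> A" using assms by (intro conn_closed[of V E x A]) auto
    with \<open>\<not> V \<subseteq> A\<close> show False by simp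
  qed
qed

lemma rtrancl_vpath:
  "(x, y) \<in> E\<^sup>* \<Longrightarrow> \<exists>xs. xs \<noteq> [] \<and> distinct xs \<and> hd xs = x \<and> last xs = y \<and> set (vwalk_arcs xs) \<subseteq> E"
proof (induction rule: converse_rtrancl_induct)
  case base
  show ?case by (rule exI[of _ "[y]"]) simp
next
  case (step x z)
  then obtain xs where xs: "xs \<noteq> []" "distinct xs" "hd xs = z" "last xs = y" "set (vwalk_arcs xs) \<subseteq> E"
    by blast
  show ?case
  proof (cases "x \<in> set xs")
    case False
    then show ?thesis using xs step(1) by (intro exI[of _ "x # xs"]) auto
  next
    case True
    \<comment> \<open>Cutting back to the earlier occurrence of \<open>x\<close> keeps the path free
      of repetitions.\<close>
    then obtain as bs where "xs = as @ x # bs" by (meson split_list)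
    then show ?thesis using xs
      by (intro exI[of _ "x # bs"]) (cases "as = []"; auto simp: vwalk_arcs_append)
  qed
qed

section \<open>Cycles as closed vertex lists\<close>

definition ring_arcs :: "'a list \<Rightarrow> 'a rel" where
  "ring_arcs xs = insert (last xs, hd xs) (set (vwalk_arcs xs))"

text \<open>With both orientations of every arc, the graph depends neither on the starting vertex
  nor on the direction, so the list may be rotated to suit each argument.\<close>

definition ring :: "'a list \<Rightarrow> 'a pair_pre_digraph" where
  "ring xs = \<lparr>pverts = set xs, parcs = ring_arcs xs \<union> (ring_arcs xs)\<inverse>\<rparr>"

lemma ring_simps [simp]:
  "pverts (ring xs) = set xs" "parcs (ring xs) = ring_arcs xs \<union> (ring_arcs xs)\<inverse>"
  by (simp_all add: ring_def)

lemma ring_arcs_rotate: "xs \<noteq> [] \<Longrightarrow> ys \<noteq> [] \<Longrightarrow> ring_arcs (xs @ ys) = ring_arcs (ys @ xs)"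
  by (auto simp: ring_arcs_def vwalk_arcs_append)

lemma ring_rotate: "ring (xs @ ys) = ring (ys @ xs)"
  by (cases "xs = []"; cases "ys = []") (auto simp: ring_def ring_arcs_rotate)

lemma ring_start_at:
  assumes "v \<in> set xs" "distinct xs"
  obtains ys where "ring xs = ring (v # ys)" "distinct (v # ys)" "length xs = Suc (length ys)"
proof -
  obtain as bs where *: "xs = as @ v # bs" using assms(1) by (meson split_list)
  have "ring xs = ring (v # bs @ as)" unfolding * by (subst ring_rotate) simp
  then show thesis by (rule that) (use assms(2) * in auto)
qed

lemma vwalk_arcs_in_set: "(u, v) \<in> set (vwalk_arcs xs) \<Longrightarrow> u \<in> set xs \<and> v \<in> set xs"
  by (elim in_set_vwalk_arcsE) auto

lemma ring_arcs_in_set: "xs \<noteq> [] \<Longrightarrow> ring_arcs xs \<subseteq> set xs \<times> set xs"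
  by (auto simp: ring_arcs_def dest: vwalk_arcs_in_set)

lemma sym_ring: "sym (parcs (ring xs))"
  by (simp add: sym_Un_converse)

lemma vwalk_arcs_neq: "distinct xs \<Longrightarrow> (u, v) \<in> set (vwalk_arcs xs) \<Longrightarrow> u \<noteq> v"
  by (induction xs rule: vwalk_arcs.induct) auto

lemma pair_graphI:
  assumes "finite (pverts G)" "parcs G \<subseteq> pverts G \<times> pverts G" "sym (parcs G)" "irrefl (parcs G)"
  shows "pair_graph G"
proof
  show "finite (parcs G)" using assms(1,2) finite_subset by blast
  show "symmetric (with_proj G)" using assms(3) by (simp add: symmetric_def)
qed (use assms in \<open>auto simp: irrefl_def\<close>)

lemma pair_graphD:
  assumes "pair_graph G"
  shows "finite (pverts G)" "finite (parcs G)" "parcs G \<subseteq> pverts G \<times> pverts G" "sym (parcs G)"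
    "irrefl (parcs G)"
proof -
  interpret pair_graph G by fact
  show "finite (pverts G)" "finite (parcs G)" by auto
  show "parcs G \<subseteq> pverts G \<times> pverts G" by (auto dest: in_arcsD1 in_arcsD2)
  show "sym (parcs G)" by (auto intro: symI arcs_symmetric)
  show "irrefl (parcs G)" by (auto simp: irrefl_def dest: no_loops')
qed

lemma pair_graph_arcD:
  assumes "pair_graph G" "(a, b) \<in> parcs G"
  shows "a \<in> pverts G \<and> b \<in> pverts G \<and> a \<noteq> b"
  using pair_graphD(3,5)[OF assms(1)] assms(2) by (auto simp: irrefl_def)

lemma pair_graph_ring:
  assumes "distinct xs" "3 \<le> length xs"
  shows "pair_graph (ring xs)"
proof (rule pair_graphI)
  have "xs \<noteq> []" using assms(2) by auto
  then show "parcs (ring xs) \<subseteq> pverts (ring xs) \<times> pverts (ring xs)"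
    using ring_arcs_in_set[of xs] by auto
  have "last xs \<noteq> hd xs"
  proof (cases xs)
    case (Cons x ys)
    then show ?thesis using assms by (cases ys) auto
  qed (use assms in simp)
  then have "u \<noteq> v" if "(u, v) \<in> ring_arcs xs" for u v
    using that vwalk_arcs_neq[OF assms(1)] unfolding ring_arcs_def by blast
  then show "irrefl (parcs (ring xs))"
    unfolding irrefl_def ring_simps by blast
qed (simp_all add: sym_Un_converse)

lemma ring_neighbours:
  assumes "distinct xs" "3 \<le> length xs" "v \<in> set xs"
  shows "card {w. (v, w) \<in> parcs (ring xs)} = 2"
proof -
  obtain ys where ys: "ring xs = ring (v # ys)" "distinct (v # ys)" "length xs = Suc (length ys)"
    using ring_start_at assms by metis
  obtain y z zs where yz: "ys = y # z # zs"
    using ys(3) assms(2) by (cases ys; cases "tl ys") auto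
  have "{w. (v, w) \<in> parcs (ring (v # ys))} = {hd ys, last ys}"
    using ys(2) vwalk_arcs_in_set[of _ _ "y # z # zs"] unfolding yz
    by (fastforce simp: ring_arcs_def)
  moreover have "hd ys \<noteq> last ys" using ys(2) yz by (auto split: if_splits)
  ultimately show ?thesis using ys(1) by simp
qed

lemma conn_ring: "xs \<noteq> [] \<Longrightarrow> conn (set xs) (parcs (ring xs))"
  using sym_ring[of xs] by (intro conn_vwalk) (auto simp: ring_arcs_def)

lemma conn_ring_del_vert:
  assumes "distinct xs" "2 \<le> length xs" "v \<in> set xs"
  shows "conn (set xs - {v}) (parcs (ring xs))"
proof -
  obtain ys where ys: "ring xs = ring (v # ys)" "distinct (v # ys)" "length xs = Suc (length ys)"
    using ring_start_at assms by metis
  have "conn (set ys) (parcs (ring (v # ys)))"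
    using ys assms(2) sym_ring[of "v # ys"] by (intro conn_vwalk) (auto simp: ring_arcs_def)
  moreover have "set xs - {v} = set ys"
    using arg_cong[OF ys(1), of pverts] ys(2) by auto
  ultimately show ?thesis using ys(1) by simp
qed

lemma vwalk_arcs_split:
  assumes "(a, b) \<in> set (vwalk_arcs xs)"
  obtains ys zs where "xs = ys @ zs" "ys \<noteq> []" "zs \<noteq> []" "last ys = a" "hd zs = b"
  using assms
proof (induction xs arbitrary: thesis rule: vwalk_arcs.induct)
  case (3 x y xs)
  show ?case
  proof (cases "(a, b) = (x, y)")
    case True
    then show ?thesis using 3(2)[of "[x]" "y # xs"] by simp
  next
    case False
    then have "(a, b) \<in> set (vwalk_arcs (y # xs))" using 3(3) by auto
    then obtain ys zs where "y # xs = ys @ zs" "ys \<noteq> []" "zs \<noteq> []" "last ys = a" "hd zs = b"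
      using 3(1) by blast
    then show ?thesis using 3(2)[of "x # ys" zs] by simp
  qed
qed auto

text \<open>Once a given arc is the closing one, deleting it leaves the path along the list, which
  is visibly connected.\<close>

lemma ring_close_at:
  assumes "distinct xs" "(a, b) \<in> ring_arcs xs"
  obtains ys where "ring xs = ring ys" "distinct ys" "length ys = length xs" "last ys = a" "hd ys = b"
proof (cases "(a, b) = (last xs, hd xs)")
  case True
  then show ?thesis using assms(1) that[of xs] by simp
next
  case False
  then have "(a, b) \<in> set (vwalk_arcs xs)" using assms(2) by (auto simp: ring_arcs_def)
  then obtain ys zs where "xs = ys @ zs" "ys \<noteq> []" "zs \<noteq> []" "last ys = a" "hd zs = b"
    by (rule vwalk_arcs_split)
  then show ?thesis using assms(1) that[of "zs @ ys"] by (simp add: ring_rotate[of ys zs] Int_commute)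
qed

lemma vwalk_arcs_fst_snd:
  "distinct xs \<Longrightarrow> (u, v) \<in> set (vwalk_arcs xs) \<Longrightarrow> u \<noteq> last xs \<and> v \<noteq> hd xs"
proof (induction xs rule: vwalk_arcs.induct)
  case (3 x y xs)
  then show ?case using vwalk_arcs_in_set[of u v "y # xs"] by auto
qed auto

lemma conn_ring_del_arc_aux:
  assumes "distinct xs" "3 \<le> length xs" "(a, b) \<in> ring_arcs xs"
  shows "conn (set xs) (parcs (ring xs) - {(a, b), (b, a)})"
proof -
  obtain ys where ys: "ring xs = ring ys" "distinct ys" "length ys = length xs" "last ys = a" "hd ys = b"
    using ring_close_at assms by metis
  obtain y1 y2 y3 zs where yz: "ys = y1 # y2 # y3 # zs"
    using ys(3) assms(2) by (cases ys; cases "tl ys"; cases "tl (tl ys)") auto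
  have ne: "(a, b) \<notin> set (vwalk_arcs ys)" using vwalk_arcs_fst_snd[OF ys(2)] ys(4) by auto
  \<comment> \<open>Here the length matters: with only two vertices, the path would itself consist
    of the arc \<open>(b, a)\<close>.\<close>
  have "a \<noteq> y2" using ys(2,4) yz by (auto split: if_splits)
  then have ne': "(b, a) \<notin> set (vwalk_arcs ys)"
    using ys(2,5) vwalk_arcs_in_set[of b a "y2 # y3 # zs"] unfolding yz by auto
  have "conn (set ys) (parcs (ring ys) - {(a, b), (b, a)})"
  proof (rule conn_vwalk)
    show "set (vwalk_arcs ys) \<subseteq> parcs (ring ys) - {(a, b), (b, a)}"
      using ne ne' by (auto simp: ring_arcs_def)
    show "sym (parcs (ring ys) - {(a, b), (b, a)})"
      using sym_ring[of ys] by (auto simp: sym_def)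
  qed (use yz in simp)
  moreover have "set xs = set ys" using arg_cong[OF ys(1), of pverts] by simp
  ultimately show ?thesis using ys(1) by simp
qed

lemma conn_ring_del_arc:
  assumes "distinct xs" "3 \<le> length xs" "(a, b) \<in> parcs (ring xs)"
  shows "conn (set xs) (parcs (ring xs) - {(a, b), (b, a)})"
  using conn_ring_del_arc_aux[OF assms(1,2), of a b] conn_ring_del_arc_aux[OF assms(1,2), of b a] assms(3)
  unfolding ring_simps Un_iff converse_iff by (metis insert_commute)

section \<open>From closed arc walks to vertex lists\<close>

lemma pcas_vwalk_arcs: "xs \<noteq> [] \<Longrightarrow> pcas (hd xs) (vwalk_arcs xs) (last xs)"
  by (induction xs rule: vwalk_arcs.induct) auto

lemma map_fst_vwalk_arcs: "xs \<noteq> [] \<Longrightarrow> map fst (vwalk_arcs xs) = butlast xs"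
  by (induction xs rule: vwalk_arcs.induct) auto

lemma pcas_eq_vwalk_arcs: "pcas u p v \<Longrightarrow> p = vwalk_arcs (map fst p @ [v]) \<and> hd (map fst p @ [v]) = u"
  by (induction u p v rule: pcas.induct) (auto simp: prod_eq_iff)

lemma pawalk_verts_eq: "pcas u p v \<Longrightarrow> pawalk_verts u p = map fst p @ [v]"
  by (induction u p v rule: pcas.induct) auto

text \<open>The vertex list of a closed arc walk shows the base vertex at both ends, so distinctness
  is demanded of its tail only; that tail is a rotation of \<open>xs\<close>.\<close>

lemma cycles_iff:
  assumes "pair_graph G"
  shows "C \<in> cycles G \<longleftrightarrow>
    (\<exists>xs. distinct xs \<and> 3 \<le> length xs \<and> ring_arcs xs \<subseteq> parcs G \<and> C = ring xs)"
proof
  interpret pair_graph G by fact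
  assume "C \<in> cycles G"
  then obtain p u where p: "C = \<lparr>pverts = fst ` set p, parcs = set p \<union> (set p)\<inverse>\<rparr>" "3 \<le> length p"
    "set p \<subseteq> parcs G" "pcas u p u" "distinct (tl (pawalk_verts u p))"
    by (auto simp: cycles_def cycle_def awalk_def)
  define xs where "xs = map fst p"
  have ne: "xs \<noteq> []" using p(2) by (auto simp: xs_def)
  have eq: "p = vwalk_arcs (xs @ [u])" "hd (xs @ [u]) = u"
    using pcas_eq_vwalk_arcs[OF p(4)] by (auto simp: xs_def)
  then have hd: "hd xs = u" using ne by simp
  have "distinct (tl xs @ [u])" using p(5) pawalk_verts_eq[OF p(4)] ne by (simp add: xs_def tl_append split: list.splits)
  then have "distinct xs" using ne hd by (cases xs) auto
  moreover have arcs: "set p = ring_arcs xs"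
    using ne hd by (subst eq(1)) (auto simp: ring_arcs_def vwalk_arcs_append)
  moreover have "C = ring xs" using p(1) arcs by (simp add: ring_def xs_def)
  moreover have "length xs = length p" by (simp add: xs_def)
  ultimately show "\<exists>xs. distinct xs \<and> 3 \<le> length xs \<and> ring_arcs xs \<subseteq> parcs G \<and> C = ring xs"
    using p(2,3) by auto
next
  interpret pair_graph G by fact
  assume "\<exists>xs. distinct xs \<and> 3 \<le> length xs \<and> ring_arcs xs \<subseteq> parcs G \<and> C = ring xs"
  then obtain xs where xs: "distinct xs" "3 \<le> length xs" "ring_arcs xs \<subseteq> parcs G" "C = ring xs"
    by blast
  have ne: "xs \<noteq> []" using xs(2) by auto
  define p where "p = vwalk_arcs (xs @ [hd xs])"
  have arcs: "set p = ring_arcs xs"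
    using ne by (auto simp: p_def ring_arcs_def vwalk_arcs_append)
  have fst: "map fst p = xs" unfolding p_def by (subst map_fst_vwalk_arcs) auto
  then have len: "length p = length xs" by (metis length_map)
  have cas: "pcas (hd xs) p (hd xs)"
    using pcas_vwalk_arcs[of "xs @ [hd xs]"] ne by (simp add: p_def)
  have "(last xs, hd xs) \<in> parcs G" using xs(3) by (auto simp: ring_arcs_def)
  then have "hd xs \<in> pverts G" by (rule in_arcsD2)
  moreover have "distinct (tl (pawalk_verts (hd xs) p))"
    using xs(1) ne pawalk_verts_eq[OF cas] fst by (cases xs) auto
  ultimately have "cycle p"
    using cas arcs xs(2,3) len by (auto simp: cycle_def awalk_def intro!: exI[of _ "hd xs"])
  moreover have "C = \<lparr>pverts = fst ` set p, parcs = set p \<union> (set p)\<inverse>\<rparr>"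
    using xs(4) arcs fst by (metis ring_def set_map)
  ultimately show "C \<in> cycles G" using len xs(2) by (auto simp: cycles_def)
qed

section \<open>Blocks, and the number of edges of a cactus\<close>

text \<open>Plain inclusion, without the well-formedness and compatibility conditions that
  \<open>subgraph\<close> carries; between pair graphs the two notions agree.\<close>

definition sub_graph :: "'a pair_pre_digraph \<Rightarrow> 'a pair_pre_digraph \<Rightarrow> bool" where
  "sub_graph H G \<longleftrightarrow> pverts H \<subseteq> pverts G \<and> parcs H \<subseteq> parcs G"

lemma sub_graph_trans: "sub_graph F H \<Longrightarrow> sub_graph H G \<Longrightarrow> sub_graph F G"
  by (auto simp: sub_graph_def)

lemma connected_iff_conn:
  assumes "sym (parcs G)" "parcs G \<subseteq> pverts G \<times> pverts G"
  shows "Digraph_Component.connected (with_proj G) \<longleftrightarrow> conn (pverts G) (parcs G)"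
proof -
  interpret pair_wf_digraph G by unfold_locales (use assms(2) in auto)
  have "mk_symmetric (with_proj G) = G"
    using symD[OF assms(1)]
    by (intro pair_pre_digraph.equality) (force simp: mk_symmetric_def)+
  moreover have "u \<rightarrow>\<^sup>*\<^bsub>with_proj G\<^esub> v \<longleftrightarrow> (u, v) \<in> (Restr (parcs G) (pverts G))\<^sup>*"
    if "u \<in> pverts G" "v \<in> pverts G" for u v
    using that assms(2) reachable_conv[of u v] by (simp add: inf_absorb1)
  ultimately show ?thesis
    by (auto simp: Digraph_Component.connected_def strongly_connected_def conn_def)
qed

text \<open>\<open>conn\<close> ignores arcs leaving its vertex set, so a vertex is deleted by
  shrinking that set while the arcs stay as they are.\<close>

definition nsep :: "'a pair_pre_digraph \<Rightarrow> bool" where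
  "nsep B \<longleftrightarrow> pair_graph B \<and> conn (pverts B) (parcs B) \<and>
     (\<forall>v \<in> pverts B. pverts B \<noteq> {v} \<longrightarrow> conn (pverts B - {v}) (parcs B))"

lemma nonseparable_iff_nsep: "nonseparable (with_proj B) \<longleftrightarrow> nsep B"
proof -
  have graph: "graph (with_proj B) \<longleftrightarrow> pair_graph B"
    using pair_graphI_graph pair_graph.pair_graphD_graph by blast
  have "Digraph_Component.connected (pre_digraph.del_vert (with_proj B) v) \<longleftrightarrow>
      conn (pverts B - {v}) (parcs B)" if "pair_graph B" for v
  proof -
    note B = pair_graphD[OF that]
    let ?D = "\<lparr>pverts = pverts B - {v}, parcs = {a \<in> parcs B. fst a \<noteq> v \<and> snd a \<noteq> v}\<rparr>"
    have "pre_digraph.del_vert (with_proj B) v = with_proj ?D"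
      by (simp add: pre_digraph.del_vert_def with_proj_def)
    moreover have "Digraph_Component.connected (with_proj ?D) \<longleftrightarrow> conn (pverts ?D) (parcs ?D)"
      using B(3,4) by (intro connected_iff_conn) (auto simp: sym_def)
    moreover have "Restr (parcs ?D) (pverts ?D) = Restr (parcs B) (pverts B - {v})" by auto
    ultimately show ?thesis by (simp add: conn_def)
  qed
  then show ?thesis using connected_iff_conn[of B] pair_graphD[of B]
    by (auto simp: nonseparable_def nsep_def graph)
qed

lemma subgraph_with_proj_iff:
  assumes "pair_graph G" "pair_graph H"
  shows "subgraph (with_proj H) (with_proj G) \<longleftrightarrow> sub_graph H G"
proof -
  interpret G: pair_graph G by fact
  interpret H: pair_graph H by fact
  show ?thesis using G.wf_digraph H.wf_digraph
    by (auto simp: subgraph_def sub_graph_def compatible_def)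
qed

text \<open>\<open>max_subgraph\<close> quantifies over arbitrary digraphs. A digraph containing
  \<open>with_proj B\<close> is compatible with it and so has \<open>fst\<close> and
  \<open>snd\<close> as tail and head; hence it suffices to look at pair graphs.\<close>

lemma block_iff:
  assumes "pair_graph G"
  shows "block G B \<longleftrightarrow> sub_graph B G \<and> nsep B \<and>
    (\<forall>H. sub_graph B H \<and> sub_graph H G \<and> nsep H \<longrightarrow> H = B)"
    (is "_ \<longleftrightarrow> ?R")
proof -
  have inj: "with_proj H = with_proj B \<longleftrightarrow> H = B" for H
    by (auto simp: with_proj_def pair_pre_digraph.equality)
  have all: "(\<forall>H. H \<noteq> with_proj B \<and> subgraph (with_proj B) H \<longrightarrow> \<not> (subgraph H (with_proj G) \<and> nonseparable H))
    \<longleftrightarrow> (\<forall>H. with_proj H \<noteq> with_proj B \<and> subgraph (with_proj B) (with_proj H) \<longrightarrow>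
       \<not> (subgraph (with_proj H) (with_proj G) \<and> nonseparable (with_proj H)))" (is "?A \<longleftrightarrow> ?B")
  proof
    assume B: ?B
    show ?A
    proof (intro allI impI)
      fix H assume *: "H \<noteq> with_proj B \<and> subgraph (with_proj B) H"
      then have "tail H = fst" "head H = snd" by (auto simp: subgraph_def compatible_def)
      then have "H = with_proj \<lparr>pverts = verts H, parcs = arcs H\<rparr>" by (simp add: with_proj_def)
      with B * show "\<not> (subgraph H (with_proj G) \<and> nonseparable H)" by metis
    qed
  qed blast
  show ?thesis unfolding block_def pre_digraph.max_subgraph_def all inj nonseparable_iff_nsep
    using subgraph_with_proj_iff assms by (metis nsep_def)
qed

text \<open>The size of subgraphs of \<open>G\<close> is bounded, so some nonseparable one
  containing \<open>B\<close> has largest size, and this forces maximality under inclusion.\<close>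

lemma ex_block:
  assumes "pair_graph G" "nsep B" "sub_graph B G"
  obtains B' where "block G B'" "sub_graph B B'"
proof -
  note G = pair_graphD[OF assms(1)]
  let ?P = "\<lambda>H. sub_graph B H \<and> sub_graph H G \<and> nsep H"
  let ?m = "\<lambda>H. card (pverts H) + card (parcs H)"
  have "?m H \<le> ?m G" if "?P H" for H
    using that G(1,2) by (auto simp: sub_graph_def intro!: add_mono card_mono)
  then have "\<forall>H. ?P H \<longrightarrow> ?m H < Suc (?m G)" by (simp add: less_Suc_eq_le)
  moreover have "?P B" using assms by (simp add: sub_graph_def)
  ultimately obtain M where M: "?P M" "\<And>H. ?P H \<Longrightarrow> ?m H \<le> ?m M"
    using ex_has_greatest_nat[of ?P B ?m "Suc (?m G)"] by blast
  have "H = M" if H: "sub_graph M H" "sub_graph H G" "nsep H" for H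
  proof -
    have fin: "finite (pverts H)" "finite (parcs H)"
      using H(2) G(1,2) finite_subset by (auto simp: sub_graph_def)
    have le: "card (pverts M) \<le> card (pverts H)" "card (parcs M) \<le> card (parcs H)"
      using H(1) fin by (auto simp: sub_graph_def intro: card_mono)
    have "?m H \<le> ?m M" using M H by (blast intro: sub_graph_trans)
    then have "card (pverts M) = card (pverts H)" "card (parcs M) = card (parcs H)" using le by auto
    then show "H = M" using H(1) fin unfolding sub_graph_def
      by (metis card_subset_eq pair_pre_digraph.equality old.unit.exhaust)
  qed
  then have "block G M" using M(1) block_iff[OF assms(1)] by blast
  then show thesis using that M(1) by blast
qed

section \<open>Cycles as subgraphs, and the cycles of a cactus\<close>

lemma cycles_props:
  assumes "pair_graph G" "C \<in> cycles G"
  shows "pair_graph C" "nsep C" "sub_graph C G" "3 \<le> card (pverts C)"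
    "\<And>v. v \<in> pverts C \<Longrightarrow> card {w. (v, w) \<in> parcs C} = 2"
    "\<And>a b. (a, b) \<in> parcs C \<Longrightarrow> conn (pverts C) (parcs C - {(a, b), (b, a)})"
    "\<And>v. conn (pverts C - {v}) (parcs C)"
proof -
  note G = pair_graphD[OF assms(1)]
  obtain xs where xs: "distinct xs" "3 \<le> length xs" "ring_arcs xs \<subseteq> parcs G" "C = ring xs"
    using assms cycles_iff by blast
  have ne: "xs \<noteq> []" using xs(2) by auto
  show pg: "pair_graph C" using xs pair_graph_ring by blast
  show card: "3 \<le> card (pverts C)" using xs by (simp add: distinct_card)
  show "card {w. (v, w) \<in> parcs C} = 2" if "v \<in> pverts C" for v
    using that xs ring_neighbours[of xs v] by simp
  show "conn (pverts C) (parcs C - {(a, b), (b, a)})" if "(a, b) \<in> parcs C" for a b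
    using that xs conn_ring_del_arc[of xs a b] by simp
  show del: "conn (pverts C - {v}) (parcs C)" for v
    using xs ne conn_ring[of xs] conn_ring_del_vert[of xs v] by (cases "v \<in> set xs") auto
  show "nsep C" using pg del xs conn_ring[OF ne] by (auto simp: nsep_def)
  have sub: "parcs C \<subseteq> parcs G" using xs(3,4) symD[OF G(4)] by auto
  have "v \<in> pverts G" if "v \<in> pverts C" for v
  proof -
    have "{w. (v, w) \<in> parcs C} \<noteq> {}"
      using xs ring_neighbours[of xs v] that by force
    then show ?thesis using sub G(3) by auto
  qed
  then show "sub_graph C G" using sub by (auto simp: sub_graph_def)
qed

lemma cycles_mono: "pair_graph G \<Longrightarrow> pair_graph H \<Longrightarrow> parcs H \<subseteq> parcs G \<Longrightarrow> cycles H \<subseteq> cycles G"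
  by (intro subsetI) (simp add: cycles_iff, blast)

lemma cycles_self:
  assumes "pair_graph G" "C \<in> cycles G"
  shows "C \<in> cycles C"
proof -
  obtain xs where xs: "distinct xs" "3 \<le> length xs" "C = ring xs"
    using assms cycles_iff by blast
  then have "ring_arcs xs \<subseteq> parcs C" by simp
  then show ?thesis using cycles_iff[OF cycles_props(1)[OF assms]] xs by blast
qed

text \<open>Being a cycle depends only on the arcs of \<open>C\<close> itself, so the surrounding
  graph can be exchanged.\<close>

lemma cycles_of_sub_graph:
  assumes "pair_graph G" "pair_graph H" "C \<in> cycles G" "sub_graph C H"
  shows "C \<in> cycles H"
  using cycles_self[OF assms(1,3)] cycles_mono[OF assms(2) cycles_props(1)[OF assms(1,3)]] assms(4)
  by (auto simp: sub_graph_def)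

lemma finite_cycles:
  assumes "pair_graph G"
  shows "finite (cycles G)"
proof (rule finite_subset)
  note G = pair_graphD[OF assms]
  show "finite ((\<lambda>(V, E). \<lparr>pverts = V, parcs = E\<rparr>) ` (Pow (pverts G) \<times> Pow (parcs G)))"
    using G(1,2) by simp
  show "cycles G \<subseteq> (\<lambda>(V, E). \<lparr>pverts = V, parcs = E\<rparr>) ` (Pow (pverts G) \<times> Pow (parcs G))"
  proof
    fix C assume C: "C \<in> cycles G"
    have "C = (\<lambda>(V, E). \<lparr>pverts = V, parcs = E\<rparr>) (pverts C, parcs C)" by simp
    moreover have "(pverts C, parcs C) \<in> Pow (pverts G) \<times> Pow (parcs G)"
      using cycles_props(3)[OF assms C] by (simp add: sub_graph_def)
    ultimately show "C \<in> (\<lambda>(V, E). \<lparr>pverts = V, parcs = E\<rparr>) ` (Pow (pverts G) \<times> Pow (parcs G))"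
      by blast
  qed
qed

text \<open>Both graphs are 2-regular, so at a vertex of \<open>C\<close> all arcs of
  \<open>D\<close> already belong to \<open>C\<close>. Thus the vertices of \<open>C\<close> are
  closed under the arcs of the connected graph \<open>D\<close>.\<close>

lemma cycle_sub_cycle_eq:
  assumes "pair_graph G" "pair_graph H" "C \<in> cycles G" "D \<in> cycles H" "sub_graph C D"
  shows "C = D"
proof -
  note C = cycles_props[OF assms(1,3)] and D = cycles_props[OF assms(2,4)]
  note C' = pair_graphD[OF C(1)] and D' = pair_graphD[OF D(1)]
  have eq: "{w. (v, w) \<in> parcs C} = {w. (v, w) \<in> parcs D}" if "v \<in> pverts C" for v
  proof (rule card_subset_eq)
    have "{w. (v, w) \<in> parcs D} \<subseteq> pverts D" using D'(3) by auto
    then show "finite {w. (v, w) \<in> parcs D}" using D'(1) finite_subset by blast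
  qed (use assms(5) C(5) D(5) that in \<open>auto simp: sub_graph_def\<close>)
  obtain x where "x \<in> pverts C" using C(4) by fastforce
  moreover have "v \<in> pverts C" if "u \<in> pverts C" "(u, v) \<in> parcs D" for u v
    using eq[OF that(1)] that(2) C'(3) by blast
  ultimately have "pverts D \<subseteq> pverts C"
    using D(2) assms(5) by (intro conn_closed[of _ "parcs D" x]) (auto simp: nsep_def sub_graph_def)
  then have "pverts C = pverts D" using assms(5) by (auto simp: sub_graph_def)
  moreover have "parcs C = parcs D"
    using eq C'(3) D'(3) calculation by (auto 4 4)
  ultimately show ?thesis by (simp add: pair_pre_digraph.equality)
qed

text \<open>Of two common vertices, at least one survives the deletion of any vertex and still links
  the two connected remainders.\<close>

lemma nsep_Un:
  assumes "nsep A" "nsep B" "a \<in> pverts A \<inter> pverts B" "b \<in> pverts A \<inter> pverts B" "a \<noteq> b"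
  shows "nsep \<lparr>pverts = pverts A \<union> pverts B, parcs = parcs A \<union> parcs B\<rparr>"
proof -
  let ?U = "\<lparr>pverts = pverts A \<union> pverts B, parcs = parcs A \<union> parcs B\<rparr>"
  have pg: "pair_graph A" "pair_graph B" using assms by (auto simp: nsep_def)
  note A = pair_graphD[OF pg(1)] and B = pair_graphD[OF pg(2)]
  have "pair_graph ?U"
    by (rule pair_graphI) (use A B in \<open>auto simp: sym_Un irrefl_def\<close>)
  moreover have "conn (pverts A \<union> pverts B) (parcs A \<union> parcs B)"
    using assms by (intro conn_Un_Un) (auto simp: nsep_def)
  moreover have "conn (pverts A \<union> pverts B - {v}) (parcs A \<union> parcs B)" for v
  proof -
    have "pverts A \<noteq> {v}" "pverts B \<noteq> {v}" using assms(3-5) by auto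
    then have "conn (pverts A - {v}) (parcs A)" "conn (pverts B - {v}) (parcs B)"
      using assms(1,2) by (cases "v \<in> pverts A"; cases "v \<in> pverts B"; simp add: nsep_def)+
    moreover have "(pverts A - {v}) \<inter> (pverts B - {v}) \<noteq> {}" using assms(3-5) by auto
    ultimately have "conn ((pverts A - {v}) \<union> (pverts B - {v})) (parcs A \<union> parcs B)"
      by (intro conn_Un_Un)
    then show ?thesis by (simp add: Un_Diff)
  qed
  ultimately show ?thesis by (simp add: nsep_def)
qed

lemma cactusD:
  assumes "cactus G"
  shows "pair_graph G" "conn (pverts G) (parcs G)"
  using assms connected_iff_conn[of G] pair_graphD[of G] by (auto simp: cactus_def)

text \<open>The block around \<open>B\<close> has at least three vertices, so of the two shapes
  allowed in a cactus only the cycle is left.\<close>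

lemma cactus_nsep_sub_cycle:
  assumes "cactus G" "nsep B" "sub_graph B G" "3 \<le> card (pverts B)"
  obtains C where "C \<in> cycles G" "sub_graph B C"
proof -
  note G = cactusD[OF assms(1)]
  obtain D where D: "block G D" "sub_graph B D" using ex_block[OF G(1) assms(2,3)] .
  then consider u v where "u \<noteq> v" "D = \<lparr>pverts = {u, v}, parcs = {(u, v), (v, u)}\<rparr>" | "D \<in> cycles G"
    using assms(1) unfolding cactus_def by blast
  then show thesis
  proof cases
    case 1
    then have "card (pverts B) \<le> card {u, v}" using D(2) by (intro card_mono) (auto simp: sub_graph_def)
    then show ?thesis using 1 assms(4) by simp
  qed (use that D(2) in blast)
qed

lemma cactus_cycles_eq:
  assumes "cactus G" "C \<in> cycles G" "D \<in> cycles G"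
    "a \<in> pverts C \<inter> pverts D" "b \<in> pverts C \<inter> pverts D" "a \<noteq> b"
  shows "C = D"
proof -
  note G = cactusD(1)[OF assms(1)]
  note C = cycles_props[OF G assms(2)] and D = cycles_props[OF G assms(3)]
  let ?U = "\<lparr>pverts = pverts C \<union> pverts D, parcs = parcs C \<union> parcs D\<rparr>"
  have U: "nsep ?U" by (rule nsep_Un[OF C(2) D(2) assms(4-6)])
  have "sub_graph ?U G" using C(3) D(3) by (simp add: sub_graph_def)
  moreover have "3 \<le> card (pverts ?U)"
  proof (rule order_trans[OF C(4)], rule card_mono)
    show "finite (pverts ?U)" using U unfolding nsep_def by (intro pair_graphD(1)) blast
  qed simp
  ultimately obtain B where B: "B \<in> cycles G" "sub_graph ?U B"
    using cactus_nsep_sub_cycle[OF assms(1) U] by blast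
  then have "sub_graph C B" "sub_graph D B" by (auto simp: sub_graph_def)
  then show ?thesis using cycle_sub_cycle_eq[OF G G] assms(2,3) B(1) by metis
qed

text \<open>The form of the cactus property used for counting: it does not mention blocks and is
  clearly inherited when an edge is deleted.\<close>

definition edge_disjoint_cycles :: "'a pair_pre_digraph \<Rightarrow> bool" where
  "edge_disjoint_cycles G \<longleftrightarrow>
     (\<forall>C \<in> cycles G. \<forall>D \<in> cycles G. parcs C \<inter> parcs D \<noteq> {} \<longrightarrow> C = D)"

lemma cactus_edge_disjoint_cycles: "cactus G \<Longrightarrow> edge_disjoint_cycles G"
  unfolding edge_disjoint_cycles_def
proof (intro ballI impI)
  fix C D assume *: "cactus G" "C \<in> cycles G" "D \<in> cycles G" "parcs C \<inter> parcs D \<noteq> {}"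
  then obtain a b where ab: "(a, b) \<in> parcs C" "(a, b) \<in> parcs D" by auto
  note G = cactusD(1)[OF *(1)]
  show "C = D"
    using ab pair_graphD(3,5)[OF cycles_props(1)[OF G *(2)]] pair_graphD(3)[OF cycles_props(1)[OF G *(3)]]
    by (intro cactus_cycles_eq[OF *(1-3), of a b]) (auto simp: irrefl_def)
qed

section \<open>Spanning trees and the number of arcs\<close>

lemma arc_in_cycle:
  assumes "pair_graph G" "(a, b) \<in> parcs G" "(b, a) \<in> (parcs G - {(a, b), (b, a)})\<^sup>*"
  obtains C where "C \<in> cycles G" "(a, b) \<in> parcs C"
proof -
  note G = pair_graphD[OF assms(1)]
  obtain xs where xs: "xs \<noteq> []" "distinct xs" "hd xs = b" "last xs = a"
    "set (vwalk_arcs xs) \<subseteq> parcs G - {(a, b), (b, a)}"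
    using rtrancl_vpath[OF assms(3)] by blast
  have "a \<noteq> b" using assms(2) G(5) by (auto simp: irrefl_def)
  then obtain y z zs where "xs = y # z # zs" using xs(1,3,4) by (cases xs; cases "tl xs") auto
  then have "3 \<le> length xs" using xs(3-5) by (cases zs) auto
  moreover have "ring_arcs xs \<subseteq> parcs G" using xs assms(2) by (auto simp: ring_arcs_def)
  ultimately have "ring xs \<in> cycles G" using cycles_iff[OF assms(1)] xs(2) by blast
  then show thesis using that xs by (simp add: ring_arcs_def)
qed

text \<open>The tree grows by one vertex and two arcs at a time along an arc leaving
  \<open>S\<close>. Connectedness together with the number of arcs characterises it as a
  tree.\<close>

lemma ex_spanning_tree:
  assumes "finite V" "conn V E" "sym E" "irrefl E" "j < card V"
  shows "\<exists>S T. S \<subseteq> V \<and> card S = Suc j \<and> T \<subseteq> E \<inter> S \<times> S \<and> sym T \<and> card T = 2 * j \<and> conn S T"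
  using assms(5)
proof (induction j)
  case 0
  obtain x where "x \<in> V" using assms(2) by (auto simp: conn_def)
  then show ?case by (intro exI[of _ "{x}"] exI[of _ "{}"]) (auto simp: conn_singleton)
next
  case (Suc j)
  then obtain S T where ST: "S \<subseteq> V" "card S = Suc j" "T \<subseteq> E \<inter> S \<times> S" "sym T" "card T = 2 * j" "conn S T"
    by auto
  have fin: "finite S" using ST(1) assms(1) finite_subset by blast
  obtain x where x: "x \<in> S" using ST(2) by fastforce
  have "\<not> V \<subseteq> S" using Suc(2) ST(2) fin by (metis card_mono linorder_not_le)
  then obtain u v where uv: "u \<in> S" "v \<in> V" "(u, v) \<in> E" "v \<notin> S"
    using conn_closed[OF assms(2), of x S] x ST(1) by blast
  have uv': "(v, u) \<in> E" "u \<noteq> v" using uv assms(3) by (auto dest: symD)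
  let ?T = "insert (u, v) (insert (v, u) T)"
  have "finite T" using ST(3) fin by (meson finite_SigmaI finite_subset le_infE)
  moreover have "(u, v) \<notin> T" "(v, u) \<notin> T" using ST(3) uv(4) by auto
  ultimately have "card ?T = 2 * Suc j" using uv'(2) ST(5) by simp
  moreover have "conn (S \<union> {u, v}) ?T"
    using conn_mono[OF ST(6), of ?T] uv(1) by (intro conn_Un conn_pair) auto
  moreover have "S \<union> {u, v} = insert v S" using uv(1) by auto
  moreover have "sym ?T" using ST(4) by (auto simp: sym_def)
  ultimately show ?case using ST(1-3) uv uv' fin
    by (intro exI[of _ "insert v S"] exI[of _ ?T]) auto
qed

text \<open>An arc outside the spanning tree would close a cycle with the tree path between its
  ends, so the tree is the whole graph.\<close>

lemma card_arcs_acyclic: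
  assumes "pair_graph G" "conn (pverts G) (parcs G)" "cycles G = {}"
  shows "card (parcs G) = 2 * (card (pverts G) - 1)"
proof -
  note G = pair_graphD[OF assms(1)]
  have "pverts G \<noteq> {}" using assms(2) by (simp add: conn_def)
  then have pos: "0 < card (pverts G)" using G(1) by (simp add: card_gt_0_iff)
  then obtain S T where ST: "S \<subseteq> pverts G" "card S = Suc (card (pverts G) - 1)" "T \<subseteq> parcs G \<inter> S \<times> S"
    "sym T" "card T = 2 * (card (pverts G) - 1)" "conn S T"
    using ex_spanning_tree[OF G(1) assms(2) G(4,5), of "card (pverts G) - 1"] by auto
  have S: "S = pverts G" using ST(1,2) pos G(1) by (intro card_subset_eq) auto
  have "parcs G \<subseteq> T"
  proof
    fix e assume e: "e \<in> parcs G"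
    obtain a b where ab: "e = (a, b)" by fastforce
    show "e \<in> T"
    proof (rule ccontr)
      assume "e \<notin> T"
      then have "T \<subseteq> parcs G - {(a, b), (b, a)}" using ST(3,4) ab by (auto dest: symD)
      moreover have "(b, a) \<in> (Restr T S)\<^sup>*" using ST(6) e ab G(3) S by (auto simp: conn_def)
      ultimately have "(b, a) \<in> (parcs G - {(a, b), (b, a)})\<^sup>*"
        using rtrancl_mono[of "Restr T S" "parcs G - {(a, b), (b, a)}"] by auto
      then show False using arc_in_cycle[OF assms(1)] e ab assms(3) by blast
    qed
  qed
  then have "T = parcs G" using ST(3) by auto
  then show ?thesis using ST(5) by simp
qed

text \<open>Deleting one edge of a cycle destroys exactly this cycle, because no other cycle uses
  the edge, and it creates none. The induction therefore lowers the number of cycles by one and the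
  number of arcs by two.\<close>

lemma card_arcs_eq:
  assumes "pair_graph G" "conn (pverts G) (parcs G)" "edge_disjoint_cycles G"
  shows "card (parcs G) = 2 * (card (pverts G) - 1) + 2 * card (cycles G)"
  using assms
proof (induction "card (cycles G)" arbitrary: G)
  case 0
  then have "cycles G = {}" using finite_cycles by force
  then show ?case using card_arcs_acyclic 0 by simp
next
  case (Suc r)
  note pg = Suc.prems(1) and G = pair_graphD[OF Suc.prems(1)]
  obtain C where C: "C \<in> cycles G" using Suc(2) by fastforce
  note C' = cycles_props[OF pg C] and C'' = pair_graphD[OF cycles_props(1)[OF pg C]]
  obtain a where "a \<in> pverts C" using C'(4) by fastforce
  then have "{w. (a, w) \<in> parcs C} \<noteq> {}" using C'(5)[of a] by force
  then obtain b where ab: "(a, b) \<in> parcs C" by blast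
  have ba: "(b, a) \<in> parcs C" "a \<noteq> b" using ab C''(4,5) by (auto simp: irrefl_def dest: symD)
  have abG: "(a, b) \<in> parcs G" "(b, a) \<in> parcs G" using ab ba C'(3) by (auto simp: sub_graph_def)
  let ?H = "\<lparr>pverts = pverts G, parcs = parcs G - {(a, b), (b, a)}\<rparr>"
  have H: "pair_graph ?H"
    using G by (intro pair_graphI) (auto simp: sym_def irrefl_def)
  \<comment> \<open>The rest of \<open>C\<close> still joins the ends of the deleted edge, so every
    walk through that edge can be rerouted.\<close>
  have "conn (pverts G) (parcs ?H)"
  proof -
    have cC: "conn (pverts C) (parcs ?H)"
      using conn_mono[OF C'(6)[OF ab], of "parcs ?H"] C'(3) by (auto simp: sub_graph_def)
    have VC: "pverts C \<subseteq> pverts G" using C'(3) by (simp add: sub_graph_def)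
    have "(u, v) \<in> (Restr (parcs ?H) (pverts G))\<^sup>*" if "u \<in> pverts C" "v \<in> pverts C" for u v
    proof -
      have "(Restr (parcs ?H) (pverts C))\<^sup>* \<subseteq> (Restr (parcs ?H) (pverts G))\<^sup>*"
        using VC by (intro rtrancl_mono) auto
      then show ?thesis using that cC unfolding conn_def by blast
    qed
    then have "(a, b) \<in> (Restr (parcs ?H) (pverts G))\<^sup>*" "(b, a) \<in> (Restr (parcs ?H) (pverts G))\<^sup>*"
      using ab C''(3) by blast+
    then have "Restr (parcs G) (pverts G) \<subseteq> (Restr (parcs ?H) (pverts G))\<^sup>*" by auto
    then have "(Restr (parcs G) (pverts G))\<^sup>* \<subseteq> (Restr (parcs ?H) (pverts G))\<^sup>*"
      by (metis rtrancl_subset_rtrancl)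
    then show ?thesis using Suc.prems(2) unfolding conn_def by blast
  qed
  moreover have cyc: "cycles ?H = cycles G - {C}"
  proof (intro equalityI subsetI)
    fix D assume D: "D \<in> cycles ?H"
    then have "D \<in> cycles G" using cycles_mono[OF pg H] by auto
    moreover have "D \<noteq> C" using cycles_props(3)[OF H D] ab by (auto simp: sub_graph_def)
    ultimately show "D \<in> cycles G - {C}" by simp
  next
    fix D assume D: "D \<in> cycles G - {C}"
    then have "parcs D \<inter> parcs C = {}" using Suc.prems(3) C by (auto simp: edge_disjoint_cycles_def)
    then have "sub_graph D ?H" using cycles_props(3)[OF pg, of D] D ab ba by (auto simp: sub_graph_def)
    then show "D \<in> cycles ?H" using cycles_of_sub_graph[OF pg H] D by auto
  qed
  moreover have "edge_disjoint_cycles ?H" using Suc.prems(3) cyc by (auto simp: edge_disjoint_cycles_def)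
  moreover have "r = card (cycles ?H)" using Suc(2) cyc C finite_cycles[OF pg] by simp
  ultimately have "card (parcs ?H) = 2 * (card (pverts ?H) - 1) + 2 * card (cycles ?H)"
    using Suc.hyps(1)[of ?H] H by simp
  moreover have "card (parcs G) = card (parcs ?H) + 2"
  proof -
    have "parcs G = insert (a, b) (insert (b, a) (parcs ?H))" using abG by auto
    then have "card (parcs G) = card (insert (a, b) (insert (b, a) (parcs ?H)))" by simp
    then show ?thesis using G(2) ba(2) by simp
  qed
  ultimately show ?case using \<open>r = card (cycles ?H)\<close> Suc(2) by simp
qed

section \<open>Gluing blocks\<close>

lemma degree_eq: "degree G v = card {w. (v, w) \<in> parcs G}"
proof -
  have "out_arcs (with_proj G) v = Pair v ` {w. (v, w) \<in> parcs G}"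
    by (auto simp: out_arcs_def)
  then show ?thesis by (simp add: out_degree_def card_image inj_on_def)
qed

definition edge_graph :: "'a \<Rightarrow> 'a \<Rightarrow> 'a pair_pre_digraph" where
  "edge_graph u v = \<lparr>pverts = {u, v}, parcs = {(u, v), (v, u)}\<rparr>"

lemma nsep_edge_graph: "u \<noteq> v \<Longrightarrow> nsep (edge_graph u v)"
  unfolding nsep_def
  by (auto simp: edge_graph_def sym_def irrefl_def insert_Diff_if conn_singleton
      intro!: pair_graphI conn_pair)

lemma ring_in_cycles_ring:
  assumes "distinct xs" "3 \<le> length xs"
  shows "ring xs \<in> cycles (ring xs)" "nsep (ring xs)"
proof -
  note pg = pair_graph_ring[OF assms]
  show "ring xs \<in> cycles (ring xs)" unfolding cycles_iff[OF pg] using assms by auto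
  then show "nsep (ring xs)" using cycles_props(2)[OF pg] by blast
qed

definition glue :: "'a pair_pre_digraph \<Rightarrow> 'a pair_pre_digraph \<Rightarrow> 'a pair_pre_digraph" where
  "glue G K = \<lparr>pverts = pverts G \<union> pverts K, parcs = parcs G \<union> parcs K\<rparr>"

lemma glue_simps [simp]:
  "pverts (glue G K) = pverts G \<union> pverts K" "parcs (glue G K) = parcs G \<union> parcs K"
  by (simp_all add: glue_def)

text \<open>\<open>K \<in> cycles K\<close> expresses that \<open>K\<close> is a cycle without
  reference to a surrounding graph.\<close>

definition cactus_block :: "'a pair_pre_digraph \<Rightarrow> bool" where
  "cactus_block K \<longleftrightarrow> nsep K \<and> ((\<exists>u v. u \<noteq> v \<and> K = edge_graph u v) \<or> K \<in> cycles K)"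

lemma cactus_block_edge: "u \<noteq> v \<Longrightarrow> cactus_block (edge_graph u v)"
  using nsep_edge_graph by (auto simp: cactus_block_def)

lemma cactus_block_ring: "distinct xs \<Longrightarrow> 3 \<le> length xs \<Longrightarrow> cactus_block (ring xs)"
  using ring_in_cycles_ring by (auto simp: cactus_block_def)

lemma cactusI:
  assumes "pair_graph G" "conn (pverts G) (parcs G)"
    "\<And>B. block G B \<Longrightarrow> (\<exists>u v. u \<noteq> v \<and> B = edge_graph u v) \<or> B \<in> cycles G"
  shows "cactus G"
  using assms connected_iff_conn[of G] pair_graphD[OF assms(1)]
  by (auto simp: cactus_def edge_graph_def)

lemma cactus_of_cactus_block:
  assumes "cactus_block K"
  shows "cactus K"
proof (rule cactusI)
  show pg: "pair_graph K" "conn (pverts K) (parcs K)" using assms by (auto simp: cactus_block_def nsep_def)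
  fix B assume "block K B"
  then have "K = B" using assms block_iff[OF pg(1)] by (auto simp: cactus_block_def sub_graph_def)
  then show "(\<exists>u v. u \<noteq> v \<and> B = edge_graph u v) \<or> B \<in> cycles K"
    using assms by (auto simp: cactus_block_def)
qed

text \<open>No arc joins the two sides once \<open>v\<close> is removed, and a nonseparable
  \<open>B\<close> stays connected without \<open>v\<close>, so it lies on one side. On the side of
  \<open>K\<close>, maximality gives \<open>B = K\<close>; on the other side, \<open>B\<close> is a
  block of \<open>G\<close>.\<close>

lemma cactus_glue:
  assumes G: "cactus G" and K: "cactus_block K" and v: "pverts G \<inter> pverts K = {v}"
  shows "cactus (glue G K)"
proof (rule cactusI)
  note pgG = cactusD[OF G]
  have pgK: "pair_graph K" "conn (pverts K) (parcs K)" "nsep K"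
    using K by (auto simp: cactus_block_def nsep_def)
  note G' = pair_graphD[OF pgG(1)] and K' = pair_graphD[OF pgK(1)]
  show pgU: "pair_graph (glue G K)"
    by (rule pair_graphI) (use G' K' in \<open>auto simp: sym_Un irrefl_def\<close>)
  show "conn (pverts (glue G K)) (parcs (glue G K))"
    using conn_Un_Un[OF pgG(2) pgK(2)] v by auto
  have only_v: "x = v" if "x \<in> pverts G" "x \<in> pverts K" for x
    using v that by auto
  have resG: "(a, b) \<notin> parcs K" if "a \<in> pverts G" "b \<in> pverts G" for a b
    using only_v pair_graph_arcD[OF pgK(1), of a b] that by metis
  have resK: "(a, b) \<notin> parcs G" if "a \<in> pverts K" "b \<in> pverts K" for a b
    using only_v pair_graph_arcD[OF pgG(1), of a b] that by metis
  fix B assume "block (glue G K) B"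
  then have sub: "sub_graph B (glue G K)" and nB: "nsep B"
    and mx: "\<And>H. sub_graph B H \<Longrightarrow> sub_graph H (glue G K) \<Longrightarrow> nsep H \<Longrightarrow> H = B"
    using block_iff[OF pgU] by blast+
  have B': "parcs B \<subseteq> pverts B \<times> pverts B" using nB pair_graphD(3) by (auto simp: nsep_def)
  have "pverts B \<subseteq> pverts G \<or> pverts B \<subseteq> pverts K"
  proof (cases "pverts B = {v}")
    case False
    then have "conn (pverts B - {v}) (parcs B)"
      using nB by (cases "v \<in> pverts B") (auto simp: nsep_def)
    moreover have "pverts B - {v} \<subseteq> (pverts G - {v}) \<union> (pverts K - {v})"
      using sub by (auto simp: sub_graph_def)
    moreover have "(a, b) \<notin> parcs B" if "a \<in> pverts G - {v}" "b \<in> pverts K - {v}" for a b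
      using that sub only_v pair_graph_arcD[OF pgG(1), of a b] pair_graph_arcD[OF pgK(1), of a b]
      unfolding sub_graph_def glue_simps by blast
    ultimately have "(pverts B - {v}) \<inter> (pverts G - {v}) = {} \<or> pverts B - {v} \<subseteq> pverts G - {v}"
      using v by (intro conn_separated[of _ "parcs B" _ "pverts K - {v}"]) auto
    then show ?thesis using sub v unfolding sub_graph_def glue_simps by blast
  qed (use v in auto)
  then show "(\<exists>u v. u \<noteq> v \<and> B = edge_graph u v) \<or> B \<in> cycles (glue G K)"
  proof
    assume "pverts B \<subseteq> pverts K"
    moreover from this have "parcs B \<subseteq> parcs K"
      using sub B' resK unfolding sub_graph_def glue_simps by (intro subrelI) blast
    ultimately have "sub_graph B K" by (simp add: sub_graph_def)
    then have "K = B" using mx pgK(3) by (auto simp: sub_graph_def)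
    then show ?thesis
      using K cycles_mono[OF pgU pgK(1)] by (auto simp: cactus_block_def)
  next
    assume "pverts B \<subseteq> pverts G"
    moreover from this have "parcs B \<subseteq> parcs G"
      using sub B' resG unfolding sub_graph_def glue_simps by (intro subrelI) blast
    ultimately have "sub_graph B G" by (simp add: sub_graph_def)
    moreover have "sub_graph G (glue G K)" by (auto simp: sub_graph_def)
    ultimately have "block G B"
      unfolding block_iff[OF pgG(1)] using mx nB sub_graph_trans by blast
    then have "(\<exists>u v. u \<noteq> v \<and> B = edge_graph u v) \<or> B \<in> cycles G"
      using G by (auto simp: cactus_def edge_graph_def)
    then show ?thesis using cycles_mono[OF pgU pgG(1)] by auto
  qed
qed

text \<open>A common arc would need two common vertices, so the neighbourhoods are disjoint. Outside
  a graph the degree is 0, hence additivity holds at every \<open>u\<close>, not just at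
  \<open>v\<close>.\<close>

lemma degree_glue:
  assumes "pair_graph G" "pair_graph K" "pverts G \<inter> pverts K = {v}"
  shows "degree (glue G K) u = degree G u + degree K u"
proof -
  note G = pair_graphD[OF assms(1)] and K = pair_graphD[OF assms(2)]
  have "finite {w. (u, w) \<in> parcs G}" "finite {w. (u, w) \<in> parcs K}"
    using G(1,3) K(1,3) by (auto intro: finite_subset)
  moreover have "{w. (u, w) \<in> parcs G} \<inter> {w. (u, w) \<in> parcs K} = {}"
  proof -
    have "x = v" if "x \<in> pverts G" "x \<in> pverts K" for x using assms(3) that by auto
    then have "(u, w) \<notin> parcs K" if "(u, w) \<in> parcs G" for w
      using pair_graph_arcD[OF assms(1) that] pair_graph_arcD[OF assms(2), of u w] by metis
    then show ?thesis by auto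
  qed
  moreover have "{w. (u, w) \<in> parcs (glue G K)} = {w. (u, w) \<in> parcs G} \<union> {w. (u, w) \<in> parcs K}"
    by auto
  ultimately show ?thesis by (simp add: degree_eq card_Un_disjoint)
qed

lemma degree_outside:
  assumes "pair_graph G" "u \<notin> pverts G"
  shows "degree G u = 0"
proof -
  have "{w. (u, w) \<in> parcs G} = {}" using pair_graphD(3)[OF assms(1)] assms(2) by auto
  then show ?thesis by (simp add: degree_eq)
qed

lemma degree_sequence_glue:
  assumes G: "pair_graph G" and K: "pair_graph K" and v: "pverts G \<inter> pverts K = {v}"
    and seq: "degree_sequence G = add_mset (degree G v) M"
  shows "degree_sequence (glue G K) =
    add_mset (degree G v + degree K v) (M + image_mset (degree K) (mset_set (pverts K - {v})))"
proof -
  note G' = pair_graphD[OF G] and K' = pair_graphD[OF K]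
  have vG: "v \<in> pverts G" using v by auto
  have "mset_set (pverts G) = add_mset v (mset_set (pverts G - {v}))"
    using vG G'(1) by (metis finite_Diff insert_Diff_single insert_absorb mset_set.remove)
  then have M: "M = image_mset (degree G) (mset_set (pverts G - {v}))"
    using seq by (simp add: degree_sequence_def)
  have "pverts (glue G K) = insert v ((pverts G - {v}) \<union> (pverts K - {v}))"
    using vG v by auto
  moreover have "(pverts G - {v}) \<inter> (pverts K - {v}) = {}" using v by auto
  ultimately have "mset_set (pverts (glue G K)) =
      add_mset v (mset_set (pverts G - {v}) + mset_set (pverts K - {v}))"
    using G'(1) K'(1) by (simp add: mset_set_Union)
  moreover have "image_mset (degree (glue G K)) (mset_set (pverts G - {v})) =
      image_mset (degree G) (mset_set (pverts G - {v}))"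
  proof (rule image_mset_cong)
    fix u assume "u \<in># mset_set (pverts G - {v})"
    then have "u \<in> pverts G - {v}" using G'(1) by simp
    then have "u \<notin> pverts K" using v by blast
    then show "degree (glue G K) u = degree G u"
      using degree_outside[OF K, of u] by (simp only: degree_glue[OF G K v]) simp
  qed
  moreover have "image_mset (degree (glue G K)) (mset_set (pverts K - {v})) =
      image_mset (degree K) (mset_set (pverts K - {v}))"
  proof (rule image_mset_cong)
    fix u assume "u \<in># mset_set (pverts K - {v})"
    then have "u \<in> pverts K - {v}" using K'(1) by simp
    then have "u \<notin> pverts G" using v by blast
    then show "degree (glue G K) u = degree K u"
      using degree_outside[OF G, of u] by (simp only: degree_glue[OF G K v]) simp
  qed
  ultimately show ?thesis
    by (simp add: degree_sequence_def M degree_glue[OF G K v])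
qed

text \<open>Degree multisets of cacti grown from a triangle by gluing edges and triangles. Only the
  degree \<open>d\<close> of the gluing vertex is recorded, since any vertex of that degree serves
  equally well.\<close>

inductive cactus_degrees :: "nat multiset \<Rightarrow> bool" where
  triangle: "cactus_degrees {#2, 2, 2#}"
| add_edge: "cactus_degrees (add_mset d M) \<Longrightarrow> cactus_degrees (add_mset (d + 1) (M + {#1#}))"
| add_triangle: "cactus_degrees (add_mset d M) \<Longrightarrow> cactus_degrees (add_mset (d + 2) (M + {#2, 2#}))"

lemma obtain_vertex_of_degree:
  assumes "degree_sequence G = add_mset d M" "finite (pverts G)"
  obtains v where "v \<in> pverts G" "degree G v = d"
proof -
  have "d \<in># degree_sequence G" using assms(1) by simp
  then show thesis using that assms(2) by (auto simp: degree_sequence_def)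
qed

lemma degree_ring: "distinct xs \<Longrightarrow> 3 \<le> length xs \<Longrightarrow> v \<in> set xs \<Longrightarrow> degree (ring xs) v = 2"
  using ring_neighbours degree_eq by metis

lemma degree_edge_graph: "u \<noteq> v \<Longrightarrow> degree (edge_graph u v) u = 1" "u \<noteq> v \<Longrightarrow> degree (edge_graph u v) v = 1"
  by (simp_all add: degree_eq edge_graph_def)

text \<open>The vertex set is prescribed because a competitor must live in the same type as
  \<open>G\<close>, which may be finite; it is later built on the vertices of
  \<open>G\<close>.\<close>

lemma ex_cactus_with_degrees:
  assumes "cactus_degrees M" "finite V" "card V = size M"
  shows "\<exists>G. cactus G \<and> pverts G = V \<and> degree_sequence G = M"
  using assms
proof (induction arbitrary: V rule: cactus_degrees.induct)
  case triangle
  then have "card V = 3" by simp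
  then obtain a b c where abc: "V = {a, b, c}" "a \<noteq> b" "a \<noteq> c" "b \<noteq> c"
    by (auto simp: card_3_iff)
  let ?K = "ring [a, b, c]"
  have "degree ?K a = 2" "degree ?K b = 2" "degree ?K c = 2"
    using abc by (auto intro!: degree_ring)
  then have "degree_sequence ?K = {#2, 2, 2#}"
    using abc by (simp add: degree_sequence_def)
  moreover have "cactus ?K"
    using abc by (intro cactus_of_cactus_block cactus_block_ring) auto
  ultimately show ?case using abc(1) by (intro exI[of _ ?K]) simp
next
  case (add_edge d M)
  have "card V = Suc (size (add_mset d M))" using add_edge.prems by simp
  then obtain w V' where w: "V = insert w V'" "w \<notin> V'" "card V' = size (add_mset d M)"
    unfolding card_Suc_eq by blast
  then obtain G where G: "cactus G" "pverts G = V'" "degree_sequence G = add_mset d M"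
    using add_edge.IH[of V'] add_edge.prems(1) by auto
  obtain v where v: "v \<in> V'" "degree G v = d"
    using obtain_vertex_of_degree[OF G(3)] G(2) w(1) add_edge.prems(1) by auto
  let ?K = "edge_graph v w"
  have vw: "v \<noteq> w" using v w by auto
  have K: "cactus_block ?K" using cactus_block_edge[OF vw] .
  have int: "pverts G \<inter> pverts ?K = {v}" using G(2) v w by (auto simp: edge_graph_def)
  have "cactus (glue G ?K)" using cactus_glue[OF G(1) K int] .
  moreover have "pverts ?K - {v} = {w}" using vw by (auto simp: edge_graph_def)
  then have "degree_sequence (glue G ?K) = add_mset (d + 1) (M + {#1#})"
    using degree_sequence_glue[OF cactusD(1)[OF G(1)] _ int, of M] G(3) v K vw
    by (simp add: cactus_block_def nsep_def degree_edge_graph)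
  moreover have "pverts (glue G ?K) = V" using G(2) w v by (auto simp: edge_graph_def)
  ultimately show ?case by blast
next
  case (add_triangle d M)
  have "card V = Suc (Suc (size (add_mset d M)))" using add_triangle.prems by simp
  then obtain a V\<^sub>1 where a: "V = insert a V\<^sub>1" "a \<notin> V\<^sub>1" "card V\<^sub>1 = Suc (size (add_mset d M))"
    unfolding card_Suc_eq by blast
  then obtain b V' where "V\<^sub>1 = insert b V'" "b \<notin> V'" "card V' = size (add_mset d M)"
    unfolding card_Suc_eq by blast
  with a have w: "V = insert a (insert b V')" "a \<noteq> b" "a \<notin> V'" "b \<notin> V'"
    "card V' = size (add_mset d M)" by auto
  then obtain G where G: "cactus G" "pverts G = V'" "degree_sequence G = add_mset d M"
    using add_triangle.IH[of V'] add_triangle.prems(1) by auto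
  obtain v where v: "v \<in> V'" "degree G v = d"
    using obtain_vertex_of_degree[OF G(3)] G(2) w(1) add_triangle.prems(1) by auto
  let ?K = "ring [v, a, b]"
  have dist: "distinct [v, a, b]" using v w by auto
  have K: "cactus_block ?K" using cactus_block_ring[OF dist] by simp
  have int: "pverts G \<inter> pverts ?K = {v}" using G(2) v w by auto
  have "cactus (glue G ?K)" using cactus_glue[OF G(1) K int] .
  moreover have "pverts ?K - {v} = {a, b}" using dist by auto
  moreover have "degree ?K v = 2" "degree ?K a = 2" "degree ?K b = 2"
    using dist by (auto intro!: degree_ring)
  ultimately have "degree_sequence (glue G ?K) = add_mset (d + 2) (M + {#2, 2#})"
    using degree_sequence_glue[OF cactusD(1)[OF G(1)] _ int, of M] G(3) v K dist
    by (simp add: cactus_block_def nsep_def del: ring_simps)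
  moreover have "pverts (glue G ?K) = V" using G(2) w v by auto
  ultimately show ?case using \<open>cactus (glue G ?K)\<close> by blast
qed

section \<open>Cycle degrees and bridge degrees\<close>

definition cycle_degree :: "'a pair_pre_digraph \<Rightarrow> 'a \<Rightarrow> nat" where
  "cycle_degree G v = card {C \<in> cycles G. v \<in> pverts C}"

definition bridges :: "'a pair_pre_digraph \<Rightarrow> 'a rel" where
  "bridges G = parcs G - (\<Union>C \<in> cycles G. parcs C)"

definition bridge_degree :: "'a pair_pre_digraph \<Rightarrow> 'a \<Rightarrow> nat" where
  "bridge_degree G v = card {w. (v, w) \<in> bridges G}"

text \<open>Every edge is represented by both of its arcs, so the number of such bridges is half the
  cardinality.\<close>

definition inner_bridges :: "'a pair_pre_digraph \<Rightarrow> 'a rel" where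
  "inner_bridges G = bridges G \<inter> nonpendant G \<times> nonpendant G"

lemma degree_split:
  assumes "pair_graph G" "edge_disjoint_cycles G"
  shows "degree G v = 2 * cycle_degree G v + bridge_degree G v"
proof -
  note G = pair_graphD[OF assms(1)]
  let ?Cs = "{C \<in> cycles G. v \<in> pverts C}"
  let ?N = "\<lambda>E. {w. (v, w) \<in> E}"
  have fin: "finite (?N E)" if "E \<subseteq> parcs G" for E
    using that G(1,3) by (auto intro!: finite_subset[of _ "pverts G"])
  have sub: "parcs C \<subseteq> parcs G" if "C \<in> cycles G" for C
    using cycles_props(3)[OF assms(1) that] by (simp add: sub_graph_def)
  have disj: "C = D" if "C \<in> cycles G" "D \<in> cycles G" "e \<in> parcs C" "e \<in> parcs D" for C D e
    using that assms(2) unfolding edge_disjoint_cycles_def by blast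
  have "?N (parcs G) = (\<Union>C \<in> ?Cs. ?N (parcs C)) \<union> ?N (bridges G)"
    using sub pair_graph_arcD[OF cycles_props(1)[OF assms(1)]] by (fastforce simp: bridges_def)
  moreover have "card ((\<Union>C \<in> ?Cs. ?N (parcs C)) \<union> ?N (bridges G)) =
      card (\<Union>C \<in> ?Cs. ?N (parcs C)) + card (?N (bridges G))"
    using fin sub finite_cycles[OF assms(1)]
    by (intro card_Un_disjoint) (auto simp: bridges_def intro: finite_subset[OF _ fin[of "parcs G"]])
  moreover have "card (\<Union>C \<in> ?Cs. ?N (parcs C)) = (\<Sum>C \<in> ?Cs. card (?N (parcs C)))"
    using fin sub finite_cycles[OF assms(1)]
    by (intro card_UN_disjoint) (auto dest: disj)
  moreover have "(\<Sum>C \<in> ?Cs. card (?N (parcs C))) = 2 * card ?Cs"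
    using cycles_props(5)[OF assms(1)] by simp
  ultimately show ?thesis by (simp add: degree_eq cycle_degree_def bridge_degree_def)
qed

lemma sum_cycle_degree:
  assumes "pair_graph G"
  shows "(\<Sum>v \<in> pverts G. cycle_degree G v) = (\<Sum>C \<in> cycles G. card (pverts C))"
proof -
  note G = pair_graphD[OF assms]
  have "(\<Sum>v \<in> pverts G. card {C \<in> cycles G. v \<in> pverts C}) =
      (\<Sum>v \<in> pverts G. \<Sum>C \<in> cycles G. if v \<in> pverts C then 1 else 0)"
    using finite_cycles[OF assms] by (simp add: sum.If_cases Int_def conj_commute)
  also have "\<dots> = (\<Sum>C \<in> cycles G. \<Sum>v \<in> pverts G. if v \<in> pverts C then 1 else 0)"
    by (rule sum.swap)
  also have "\<dots> = (\<Sum>C \<in> cycles G. card (pverts C))"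
  proof (rule sum.cong)
    fix C assume "C \<in> cycles G"
    then have "pverts G \<inter> {v. v \<in> pverts C} = pverts C"
      using cycles_props(3)[OF assms] by (auto simp: sub_graph_def)
    then show "(\<Sum>v \<in> pverts G. if v \<in> pverts C then 1 else 0) = card (pverts C)"
      using G(1) by (simp add: sum.If_cases)
  qed simp
  finally show ?thesis by (simp add: cycle_degree_def)
qed

lemma card_rel_eq_sum:
  assumes "finite V" "finite W" "E \<subseteq> V \<times> W"
  shows "card E = (\<Sum>v \<in> V. card {w. (v, w) \<in> E})"
proof -
  have "E = (SIGMA v:V. {w. (v, w) \<in> E})" using assms(3) by auto
  moreover have "\<forall>v \<in> V. finite {w. (v, w) \<in> E}"
    using assms by (auto intro: finite_subset[of _ W])
  ultimately show ?thesis using card_SigmaI[OF assms(1), of "\<lambda>v. {w. (v, w) \<in> E}"] by metis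
qed

lemma sum_degree: "pair_graph G \<Longrightarrow> (\<Sum>v \<in> pverts G. degree G v) = card (parcs G)"
  using card_rel_eq_sum[of "pverts G" "pverts G" "parcs G"] pair_graphD[of G] by (simp add: degree_eq)

section \<open>Pendant vertices of a connected graph\<close>

lemma degree_pos:
  assumes "pair_graph G" "conn (pverts G) (parcs G)" "2 \<le> card (pverts G)" "v \<in> pverts G"
  shows "1 \<le> degree G v"
proof (rule ccontr)
  assume "\<not> 1 \<le> degree G v"
  moreover have "finite {w. (v, w) \<in> parcs G}"
    using pair_graphD[OF assms(1)] by (auto intro: finite_subset[of _ "pverts G"])
  ultimately have "{w. (v, w) \<in> parcs G} = {}" by (simp add: degree_eq not_le)
  then have "pverts G \<subseteq> {v}" using assms(2,4) by (intro conn_closed[of _ "parcs G" v]) auto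
  then have "card (pverts G) \<le> 1" using card_mono[of "{v}"] by fastforce
  then show False using assms(3) by simp
qed

lemma degree_1_unique:
  assumes "degree G u = 1" "(u, v) \<in> parcs G" "(u, w) \<in> parcs G"
  shows "v = w"
proof -
  obtain x where "{w. (u, w) \<in> parcs G} = {x}" using assms(1) by (auto simp: degree_eq card_1_singleton_iff)
  then have "y = x" if "(u, y) \<in> parcs G" for y using that by blast
  then show ?thesis using assms(2,3) by metis
qed

text \<open>Two adjacent pendant vertices are closed under adjacency and would make up the whole
  connected graph.\<close>

lemma pendants_not_adjacent:
  assumes "pair_graph G" "conn (pverts G) (parcs G)" "3 \<le> card (pverts G)"
    "degree G u = 1" "degree G v = 1"
  shows "(u, v) \<notin> parcs G"
proof
  assume uv: "(u, v) \<in> parcs G"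
  note G = pair_graphD[OF assms(1)]
  have vu: "(v, u) \<in> parcs G" using uv G(4) by (auto dest: symD)
  have "pverts G \<subseteq> {u, v}"
  proof (rule conn_closed[OF assms(2), of u])
    fix x y assume "x \<in> {u, v}" "(x, y) \<in> parcs G"
    then show "y \<in> {u, v}"
      using degree_1_unique[OF assms(4) uv, of y] degree_1_unique[OF assms(5) vu, of y] by auto
  qed (use uv G(3) in auto)
  then have "card (pverts G) \<le> card {u, v}" by (intro card_mono) auto
  also have "\<dots> \<le> 2" by (simp add: card_insert_if)
  finally show False using assms(3) by simp
qed

text \<open>\<open>n_ge\<close> excludes the single vertex, whose degree 0 would count as
  nonpendant, and the single edge, whose pendant vertices are adjacent.\<close>

locale big_cactus =
  fixes G :: "'a pair_pre_digraph" and n k :: nat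
  assumes cactus: "cactus G" and card_verts: "card (pverts G) = n"
    and card_pendant: "card {v \<in> pverts G. degree G v = 1} = k" and n_ge: "3 \<le> n"
begin

lemmas pair_graph = cactusD(1)[OF cactus] and conn = cactusD(2)[OF cactus]
lemmas pg = pair_graphD[OF pair_graph]
lemmas edge_disjoint = cactus_edge_disjoint_cycles[OF cactus]
lemmas degree_split' = degree_split[OF pair_graph edge_disjoint]

abbreviation "pendant \<equiv> {v \<in> pverts G. degree G v = 1}"

lemma verts_split: "pverts G = nonpendant G \<union> pendant" "nonpendant G \<inter> pendant = {}"
  by (auto simp: nonpendant_def)

lemma finite_nonpendant: "finite (nonpendant G)" and finite_pendant: "finite pendant"
  using pg(1) by (auto simp: nonpendant_def)

lemma degree_nonpendant: "v \<in> nonpendant G \<Longrightarrow> 2 \<le> degree G v"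
  using degree_pos[OF pair_graph conn, of v] card_verts n_ge by (auto simp: nonpendant_def)

lemma pendant_degrees: "v \<in> pendant \<Longrightarrow> cycle_degree G v = 0 \<and> bridge_degree G v = 1"
  using degree_split'[of v] by (auto; presburger)

lemma card_nonpendant: "card (nonpendant G) + k = n"
  using card_Un_disjoint[OF finite_nonpendant finite_pendant verts_split(2)] verts_split(1)
    card_verts card_pendant by simp

lemma sum_verts: "sum f (pverts G) = sum f (nonpendant G) + sum f pendant" for f :: "'a \<Rightarrow> nat"
  by (subst verts_split(1)) (rule sum.union_disjoint[OF finite_nonpendant finite_pendant verts_split(2)])

lemma bridges_sub: "bridges G \<subseteq> parcs G"
  by (auto simp: bridges_def)

lemma sym_bridges: "sym (bridges G)"
proof (rule symI)
  fix a b assume ab: "(a, b) \<in> bridges G"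
  then have "(b, a) \<in> parcs G" using pg(4) by (auto simp: bridges_def dest: symD)
  moreover have "(b, a) \<notin> parcs C" if "C \<in> cycles G" for C
    using ab that pair_graphD(4)[OF cycles_props(1)[OF pair_graph that]]
    by (auto simp: bridges_def dest: symD)
  ultimately show "(b, a) \<in> bridges G" by (simp add: bridges_def)
qed

text \<open>A pendant vertex carries exactly one bridge, which leads to a nonpendant vertex and is
  counted in both orientations.\<close>

lemma card_bridges: "card (bridges G) = card (inner_bridges G) + 2 * k"
proof -
  let ?A = "bridges G \<inter> pendant \<times> nonpendant G"
  have fin: "finite (bridges G)" using bridges_sub pg(2) finite_subset by blast
  have np: "(u, v) \<notin> bridges G" if "u \<in> pendant" "v \<in> pendant" for u v
    using pendants_not_adjacent[OF pair_graph conn, of u v] card_verts n_ge that bridges_sub by auto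
  have in_verts: "u \<in> nonpendant G \<union> pendant" "v \<in> nonpendant G \<union> pendant" if "(u, v) \<in> bridges G" for u v
    using that bridges_sub pg(3) verts_split(1) by auto
  have split: "bridges G = inner_bridges G \<union> (?A \<union> ?A\<inverse>)"
  proof (intro equalityI subrelI)
    fix u v assume uv: "(u, v) \<in> bridges G"
    then have "(v, u) \<in> bridges G" using sym_bridges by (auto dest: symD)
    then show "(u, v) \<in> inner_bridges G \<union> (?A \<union> ?A\<inverse>)"
      using uv in_verts[OF uv] np[of u v] by (auto simp: inner_bridges_def)
  next
    fix u v assume "(u, v) \<in> inner_bridges G \<union> (?A \<union> ?A\<inverse>)"
    then show "(u, v) \<in> bridges G" using sym_bridges by (auto simp: inner_bridges_def dest: symD)
  qed
  have "card ?A = (\<Sum>v \<in> pendant. card {w. (v, w) \<in> ?A})"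
    by (rule card_rel_eq_sum[OF finite_pendant finite_nonpendant]) auto
  also have "\<dots> = (\<Sum>v \<in> pendant. bridge_degree G v)"
  proof (rule sum.cong)
    fix v assume "v \<in> pendant"
    then have "{w. (v, w) \<in> ?A} = {w. (v, w) \<in> bridges G}" using np in_verts by blast
    then show "card {w. (v, w) \<in> ?A} = bridge_degree G v" by (simp add: bridge_degree_def)
  qed simp
  also have "\<dots> = k" using pendant_degrees card_pendant by simp
  finally have A: "card ?A = k" .
  have finA: "finite ?A" using fin by simp
  have "card (?A \<union> ?A\<inverse>) = card ?A + card (?A\<inverse>)"
    using finA verts_split(2) by (intro card_Un_disjoint) auto
  moreover have "card (bridges G) = card (inner_bridges G) + card (?A \<union> ?A\<inverse>)"
    unfolding split[THEN arg_cong[of _ _ card]]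
    using fin finA verts_split(2) by (intro card_Un_disjoint) (auto simp: inner_bridges_def)
  ultimately show ?thesis using A by simp
qed

lemma sum_bridge_degree: "sum (bridge_degree G) (nonpendant G) = card (inner_bridges G) + k"
proof -
  have "card (bridges G) = sum (bridge_degree G) (pverts G)"
    using card_rel_eq_sum[OF pg(1) pg(1), of "bridges G"] bridges_sub pg(3) by (simp add: bridge_degree_def)
  also have "\<dots> = sum (bridge_degree G) (nonpendant G) + k"
    using sum_verts[of "bridge_degree G"] pendant_degrees card_pendant by simp
  finally show ?thesis using card_bridges by simp
qed

lemma sum_cycle_degree_nonpendant:
  "sum (cycle_degree G) (nonpendant G) = (\<Sum>C \<in> cycles G. card (pverts C))"
  using sum_verts[of "cycle_degree G"] pendant_degrees sum_cycle_degree[OF pair_graph] by simp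

lemma sum_degree_nonpendant:
  "sum (degree G) (nonpendant G) + k = 2 * (n - 1) + 2 * card (cycles G)"
  using sum_verts[of "degree G"] card_pendant sum_degree[OF pair_graph]
    card_arcs_eq[OF pair_graph conn edge_disjoint] card_verts by simp

text \<open>The degree sum of the nonpendant vertices is computed in two ways: from cycle and bridge
  degrees, and from the number of arcs. Equating the results and substituting
  \<open>n = N + k\<close> gives the formula for N.\<close>

lemma excess:
  obtains x y where "(\<Sum>C \<in> cycles G. card (pverts C)) = 3 * card (cycles G) + x"
    "card (inner_bridges G) = 2 * y" "card (nonpendant G) = 1 + 2 * card (cycles G) + x + y"
    "x = 0 \<Longrightarrow> \<forall>C \<in> cycles G. card (pverts C) \<le> 3"
proof -
  let ?r = "card (cycles G)" and ?L = "\<Sum>C \<in> cycles G. card (pverts C)"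
  define x where "x = (\<Sum>C \<in> cycles G. card (pverts C) - 3)"
  have "?L = (\<Sum>C \<in> cycles G. 3 + (card (pverts C) - 3))"
    using cycles_props(4)[OF pair_graph] by (intro sum.cong) auto
  then have L: "?L = 3 * ?r + x" by (simp add: sum.distrib x_def)
  have "sum (degree G) (nonpendant G) = 2 * ?L + card (inner_bridges G) + k"
    by (simp add: degree_split' sum.distrib sum_distrib_left[symmetric]
        sum_cycle_degree_nonpendant sum_bridge_degree)
  then have eq: "2 * (3 * ?r + x) + card (inner_bridges G) + 2 * k = 2 * (n - 1) + 2 * ?r"
    using sum_degree_nonpendant L by simp
  \<comment> \<open>All other terms of the equation are even.\<close>
  then have "even (card (inner_bridges G))" by presburger
  then obtain y where y: "card (inner_bridges G) = 2 * y" by blast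
  obtain m where m: "n = Suc m" using n_ge by (cases n) auto
  have "2 * (3 * ?r + x) + 2 * y + 2 * k = 2 * m + 2 * ?r" using eq y m by simp
  then have "card (nonpendant G) = 1 + 2 * ?r + x + y"
    using card_nonpendant m by simp
  moreover have "\<forall>C \<in> cycles G. card (pverts C) \<le> 3" if "x = 0"
    using that finite_cycles[OF pair_graph] by (auto simp: x_def)
  ultimately show thesis using that L y by blast
qed

end

section \<open>Optimisation of degree multisets\<close>

text \<open>This turns equality in the global bound into information about each single
  vertex.\<close>

lemma prod_eq_imp_eq:
  fixes f g :: "'a \<Rightarrow> real"
  assumes "finite A" "\<And>i. i \<in> A \<Longrightarrow> 0 \<le> f i \<and> f i \<le> g i \<and> 0 < g i" "prod g A \<le> prod f A" "i \<in> A"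
  shows "f i = g i"
proof (rule ccontr)
  assume "f i \<noteq> g i"
  then have less: "f i < g i" using assms(2,4) by force
  have "prod f A = f i * prod f (A - {i})" using assms(1,4) by (simp add: prod.remove)
  also have "\<dots> \<le> f i * prod g (A - {i})"
    using assms(2,4) by (intro mult_left_mono prod_mono) auto
  also have "\<dots> < g i * prod g (A - {i})"
    using assms(2) less by (intro mult_strict_right_mono prod_pos) auto
  also have "\<dots> = prod g A" using assms(1,4) by (simp add: prod.remove)
  finally show False using assms(3) by simp
qed

section \<open>The weight of a vertex and the product of all weights\<close>

lemma double_less_power2: "3 \<le> c \<Longrightarrow> 2 * real c < 2 ^ c"
  by (induction c rule: dec_induct) auto

text \<open>A further bridge adds 1 on the left and multiplies the right by 3/2, which preserves the
  strict inequality as soon as the degree is at least 2. What remains is checked directly: the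
  successors of the equality cases and the degrees 0 and 1.\<close>

lemma degree_weight_less:
  assumes "(c, e) \<notin> {(1, 0), (1, 1), (2, 0)}"
  shows "real (2 * c + e) < 2 ^ c * (3 / 2) ^ e"
  using assms
proof (induction e)
  case 0
  then have "c = 0 \<or> 3 \<le> c" by auto
  then show ?case using double_less_power2[of c] by auto
next
  case (Suc e)
  show ?case
  proof (cases "(c, e) \<in> {(1, 0), (1, 1), (2, 0)}")
    case True
    then show ?thesis using Suc.prems by (auto simp: power2_eq_square)
  next
    case False
    from Suc.IH[OF this] have IH: "real (2 * c + e) < 2 ^ c * (3 / 2) ^ e" .
    consider "2 \<le> 2 * c + e" | "c = 0" "e = 0" | "c = 0" "e = 1" by linarith
    then show ?thesis
    proof cases
      case 1
      then have "2 \<le> real (2 * c + e)" by linarith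
      with IH show ?thesis by simp
    qed auto
  qed
qed

lemma degree_weight_le: "real (2 * c + e) \<le> 2 ^ c * (3 / 2) ^ e"
proof (cases "(c, e) \<in> {(1, 0), (1, 1), (2 :: nat, 0 :: nat)}")
  case False
  then show ?thesis using degree_weight_less by (intro less_imp_le) blast
qed auto

text \<open>From \<open>2 * r + x + y = 2 * s\<close>, only the square of \<open>8 ^ s\<close>
  becomes an integer power in \<open>r\<close>, \<open>x\<close>, \<open>y\<close>; hence bounds are
  compared after squaring.\<close>

lemma le_of_square_ratio:
  fixes A B q :: real
  assumes "0 < A" "0 < B" "A\<^sup>2 * q = B\<^sup>2" "1 \<le> q"
  shows "A \<le> B" "B \<le> A \<Longrightarrow> q = 1"
proof -
  have "A\<^sup>2 * 1 \<le> A\<^sup>2 * q" using assms(4) by (intro mult_left_mono) auto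
  then have "A\<^sup>2 \<le> B\<^sup>2" using assms(3) by simp
  then show "A \<le> B" by (rule power2_le_imp_le) (use assms(2) in simp)
  assume "B \<le> A"
  then have "B\<^sup>2 \<le> A\<^sup>2" using assms(2) by (intro power_mono) auto
  then have "A\<^sup>2 * q \<le> A\<^sup>2 * 1" using assms(3) by simp
  then have "q \<le> 1" by (rule mult_left_le_imp_le) (use assms(1) in simp)
  then show "q = 1" using assms(4) by simp
qed

text \<open>The expression is the quotient of \<open>8 ^ (x + y)\<close> by
  \<open>4 ^ x * (81 / 16) ^ y\<close>: in the squared bound, a unit of \<open>x\<close> contributes
  4 and a unit of \<open>y\<close> contributes \<open>(3 / 2) ^ 4\<close>, while the same share of a
  triangle would contribute 8.\<close>

lemma excess_ratio_gt_1:
  "1 \<le> (2::real) ^ x * (128 / 81) ^ y" "2 ^ x * (128 / 81) ^ y = (1 :: real) \<Longrightarrow> x = 0 \<and> y = 0"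
proof -
  have ge: "1 \<le> (2::real) ^ x" "1 \<le> (128 / 81 :: real) ^ y" for x y by (auto intro: one_le_power)
  then show "1 \<le> (2::real) ^ x * (128 / 81) ^ y"
    using mult_mono[OF ge(1)[of x] ge(2)[of y]] by simp
  assume eq: "2 ^ x * (128 / 81) ^ y = (1 :: real)"
  have "(2::real) ^ x * 1 \<le> 2 ^ x * (128 / 81) ^ y" using ge(2)[of y] by (intro mult_left_mono) auto
  then have "(2::real) ^ x \<le> 1" using eq by simp
  then have "x = 0" using power_gt1_lemma one_less_power[of "2::real" x] by (cases x) auto
  moreover have "y = 0" using eq \<open>x = 0\<close> one_less_power[of "128 / 81 :: real" y] by (cases y) auto
  ultimately show "x = 0 \<and> y = 0" by simp
qed

lemma weight_bound_odd:
  assumes "2 * r + x + y = 2 * s"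
  shows "2 ^ (3 * r + x) * (3 / 2) ^ (k + 2 * y) \<le> (8 ^ s * (3 / 2) ^ k :: real)"
    "8 ^ s * (3 / 2) ^ k \<le> (2 ^ (3 * r + x) * (3 / 2) ^ (k + 2 * y) :: real) \<Longrightarrow> x = 0 \<and> y = 0"
proof -
  let ?A = "2 ^ (3 * r + x) * (9 / 4) ^ y :: real" and ?B = "8 ^ s :: real"
  have A: "2 ^ (3 * r + x) * (3 / 2) ^ (k + 2 * y) = ?A * (3 / 2 :: real) ^ k"
    by (simp add: power_add power_mult power2_eq_square)
  have "?A\<^sup>2 = 2 ^ (6 * r + 2 * x) * (81 / 16) ^ y"
  proof -
    have "((2::real) ^ (3 * r + x))\<^sup>2 = 2 ^ (6 * r + 2 * x)"
      unfolding power_mult[symmetric] by (simp add: algebra_simps)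
    moreover have "((9 / 4 :: real) ^ y)\<^sup>2 = ((9 / 4)\<^sup>2) ^ y"
      unfolding power_mult[symmetric] by (simp add: mult.commute)
    ultimately show ?thesis by (simp add: power_mult_distrib) (simp add: power_divide)
  qed
  also have "\<dots> * (2 ^ x * (128 / 81) ^ y) = 2 ^ (6 * r + 3 * x) * (8::real) ^ y"
  proof -
    have "(81 / 16 :: real) ^ y * (128 / 81) ^ y = 8 ^ y" by (simp flip: power_mult_distrib)
    moreover have "(2::real) ^ (6 * r + 2 * x) * 2 ^ x = 2 ^ (6 * r + 3 * x)" by (simp flip: power_add)
    moreover have "a * b * (c * d) = a * c * (b * d)" for a b c d :: real by (simp add: mult_ac)
    ultimately show ?thesis by metis
  qed
  also have "\<dots> = 8 ^ (2 * r + x + y)"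
    by (simp add: power_add power_mult)
  also have "\<dots> = ?B\<^sup>2" unfolding power_mult[symmetric] using assms by (simp add: mult.commute[of s])
  finally have eq: "?A\<^sup>2 * (2 ^ x * (128 / 81) ^ y) = ?B\<^sup>2" .
  have *: "?A \<le> ?B" "?B \<le> ?A \<Longrightarrow> 2 ^ x * (128 / 81) ^ y = (1::real)"
    using le_of_square_ratio[OF _ _ eq excess_ratio_gt_1(1)] by auto
  show "2 ^ (3 * r + x) * (3 / 2) ^ (k + 2 * y) \<le> (8 ^ s * (3 / 2) ^ k :: real)"
    unfolding A using *(1) by (intro mult_right_mono) auto
  assume "8 ^ s * (3 / 2) ^ k \<le> (2 ^ (3 * r + x) * (3 / 2) ^ (k + 2 * y) :: real)"
  then have "?B \<le> ?A" unfolding A by (simp add: mult_le_cancel_right)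
  then show "x = 0 \<and> y = 0" using *(2) excess_ratio_gt_1(2) by blast
qed

text \<open>If there is an inner bridge, one of them is split off, its factor 9/4 acting like two
  more pendant edges, and the odd bound applies. Otherwise \<open>x\<close> is odd, and splitting
  off one unit of it yields only the factor 2, which is less than 9/4.\<close>

lemma weight_bound_even:
  assumes "2 * r + x + y = 2 * s + 1"
  shows "2 ^ (3 * r + x) * (3 / 2) ^ (k + 2 * y) \<le> (8 ^ s * (9 / 4) * (3 / 2) ^ k :: real)"
    "8 ^ s * (9 / 4) * (3 / 2) ^ k \<le> (2 ^ (3 * r + x) * (3 / 2) ^ (k + 2 * y) :: real) \<Longrightarrow> x = 0 \<and> y = 1"
proof -
  have pos: "0 < (3 / 2 :: real) ^ k" by simp
  have "2 ^ (3 * r + x) * (3 / 2) ^ (k + 2 * y) \<le> (8 ^ s * (9 / 4) * (3 / 2) ^ k :: real) \<and>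
    (8 ^ s * (9 / 4) * (3 / 2) ^ k \<le> (2 ^ (3 * r + x) * (3 / 2) ^ (k + 2 * y) :: real) \<longrightarrow> x = 0 \<and> y = 1)"
  proof (cases y)
    case (Suc z)
    have "2 ^ (3 * r + x) * (3 / 2) ^ (k + 2 * y) = 2 ^ (3 * r + x) * (3 / 2) ^ ((k + 2) + 2 * z)"
      "8 ^ s * (9 / 4) * (3 / 2) ^ k = 8 ^ s * (3 / 2 :: real) ^ (k + 2)"
      using Suc by (simp_all add: power_add power2_eq_square)
    moreover have "2 * r + x + z = 2 * s" using assms Suc by simp
    ultimately show ?thesis using weight_bound_odd[of r x z s "k + 2"] Suc by auto
  next
    case 0
    then obtain w where w: "x = Suc w" using assms by (cases x) presburger+
    have "2 * r + w + 0 = 2 * s" using assms w 0 by simp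
    from weight_bound_odd(1)[OF this, of k]
    have "2 ^ (3 * r + x) * (3 / 2) ^ (k + 2 * y) \<le> 8 ^ s * 2 * (3 / 2 :: real) ^ k"
      using w 0 by simp
    also have "\<dots> < 8 ^ s * (9 / 4) * (3 / 2 :: real) ^ k" by simp
    finally show ?thesis by simp
  qed
  then show "2 ^ (3 * r + x) * (3 / 2) ^ (k + 2 * y) \<le> (8 ^ s * (9 / 4) * (3 / 2) ^ k :: real)"
    "8 ^ s * (9 / 4) * (3 / 2) ^ k \<le> (2 ^ (3 * r + x) * (3 / 2) ^ (k + 2 * y) :: real) \<Longrightarrow> x = 0 \<and> y = 1"
    by blast+
qed

section \<open>Balanced multisets and the product for a given sum\<close>

definition balanced :: "nat multiset \<Rightarrow> bool" where
  "balanced B \<longleftrightarrow> (\<forall>x \<in># B. \<forall>y \<in># B. x \<le> y + 1)"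

text \<open>With \<open>q = 1 + 1 / a\<close>, the growth ratio \<open>(d + 1) / d\<close> is at
  most \<open>q\<close> from \<open>a\<close> onwards and exceeds \<open>q\<close> below
  \<open>a\<close>, so the identity falls behind the exponential on both sides. At
  \<open>d = a\<close> the ratio equals \<open>q\<close>; strictness upwards therefore takes two
  steps.\<close>

lemma tangent_above:
  assumes "0 < a"
  shows "real (a + j) \<le> real a * (1 + 1 / real a) ^ j"
proof (induction j)
  case (Suc j)
  have "real (a + Suc j) \<le> real (a + j) * (1 + 1 / real a)"
    using assms by (simp add: field_simps)
  also have "\<dots> \<le> real a * (1 + 1 / real a) ^ j * (1 + 1 / real a)"
    using Suc by (intro mult_right_mono) auto
  finally show ?case by (simp add: mult_ac)
qed simp

lemma tangent_above_less:
  assumes "0 < a" "2 \<le> j"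
  shows "real (a + j) < real a * (1 + 1 / real a) ^ j"
proof -
  obtain i where i: "j = Suc i" "1 \<le> i" using assms(2) by (cases j) auto
  have "real (a + Suc i) < real (a + i) * (1 + 1 / real a)"
    using assms(1) i(2) by (simp add: field_simps)
  also have "\<dots> \<le> real a * (1 + 1 / real a) ^ i * (1 + 1 / real a)"
    using tangent_above[OF assms(1), of i] by (intro mult_right_mono) auto
  finally show ?thesis using i(1) by (simp add: mult_ac)
qed

lemma tangent_below:
  assumes "j < a"
  shows "real (a - j) * (1 + 1 / real a) ^ j \<le> real a \<and>
    (1 \<le> j \<longrightarrow> real (a - j) * (1 + 1 / real a) ^ j < real a)"
  using assms
proof (induction j)
  case (Suc j)
  let ?q = "1 + 1 / real a"
  have "real (a - Suc j) * ?q < real (a - j)"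
    using Suc.prems by (simp add: field_simps of_nat_diff)
  then have "real (a - Suc j) * ?q * ?q ^ j < real (a - j) * ?q ^ j"
    using Suc.prems by (intro mult_strict_right_mono zero_less_power) (auto intro: add_pos_nonneg)
  also have "\<dots> \<le> real a" using Suc by simp
  finally show ?case by (simp add: mult_ac)
qed simp

text \<open>The exponential function through \<open>(a, a)\<close> and
  \<open>(a + 1, a + 1)\<close>, a chord of the identity on a logarithmic scale. Keeping
  \<open>a\<close> and \<open>d\<close> in separate powers avoids the truncated difference
  \<open>d - a\<close>. A product of its values depends only on the number and the sum of the
  arguments.\<close>

definition chord :: "nat \<Rightarrow> nat \<Rightarrow> real" where
  "chord a d = real a / (1 + 1 / real a) ^ a * (1 + 1 / real a) ^ d"

lemma chord_eq: "0 < a \<Longrightarrow> d \<in> {a, a + 1} \<Longrightarrow> chord a d = real d"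
  by (auto simp: chord_def field_simps power_add)

lemma chord_greater:
  assumes "0 < a" "1 \<le> d" "d \<notin> {a, a + 1}"
  shows "real d < chord a d"
proof -
  let ?q = "1 + 1 / real a"
  have q: "0 < ?q" by (intro add_pos_nonneg) auto
  show ?thesis
  proof (cases "a \<le> d")
    case True
    then obtain j where j: "d = a + j" "2 \<le> j" using assms(3)
      by (metis Suc_1 Suc_eq_plus1 Suc_leI add.right_neutral insertCI le_Suc_ex le_less_Suc_eq linorder_not_le not_less_eq_eq less_one)
    have "chord a d = real a * ?q ^ j" using q j(1) by (simp add: chord_def power_add)
    then show ?thesis using tangent_above_less[OF assms(1) j(2)] j(1) by simp
  next
    case False
    then obtain j where j: "a = d + j" "1 \<le> j" by (metis le_add_diff_inverse less_or_eq_imp_le linorder_not_le zero_less_diff less_one)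
    have "real d * ?q ^ j < real a" using tangent_below[of j a] j assms(2) by simp
    moreover have "chord a d = real a / ?q ^ j" using q unfolding chord_def j(1)
      by (simp add: power_add)
    ultimately show ?thesis using q by (simp add: pos_less_divide_eq)
  qed
qed

lemma chord_ge: "0 < a \<Longrightarrow> 1 \<le> d \<Longrightarrow> real d \<le> chord a d"
  using chord_greater[of a d] chord_eq[of a d] by (metis less_imp_le order_refl)

lemma prod_mset_chord:
  "(\<Prod>d \<in># B. chord a d) = (real a / (1 + 1 / real a) ^ a) ^ size B * (1 + 1 / real a) ^ sum_mset B"
  by (induction B) (simp_all add: chord_def power_add)

lemma prod_mset_of_nat: "real (prod_mset B) = (\<Prod>d \<in># B. real d)"
  by (induction B) simp_all

lemma prod_chord_bounds:
  assumes "0 < a" "\<forall>d \<in># B. 1 \<le> d"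
  shows "0 < (\<Prod>d \<in># B. real d)" "(\<Prod>d \<in># B. real d) \<le> (\<Prod>d \<in># B. chord a d)"
proof -
  have "0 < (\<Prod>d \<in># B. real d) \<and> (\<Prod>d \<in># B. real d) \<le> (\<Prod>d \<in># B. chord a d)"
    using assms(2)
  proof (induction B)
    case (add x B)
    then have x: "1 \<le> x" and IH: "0 < (\<Prod>d \<in># B. real d)" "(\<Prod>d \<in># B. real d) \<le> (\<Prod>d \<in># B. chord a d)"
      by auto
    have "real x * (\<Prod>d \<in># B. real d) \<le> chord a x * (\<Prod>d \<in># B. chord a d)"
      using IH chord_ge[OF assms(1) x] by (intro mult_mono) simp_all
    then show ?case using IH x by simp
  qed simp
  then show "0 < (\<Prod>d \<in># B. real d)" "(\<Prod>d \<in># B. real d) \<le> (\<Prod>d \<in># B. chord a d)" by blast+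
qed

lemma balanced_range:
  assumes "balanced B" "B \<noteq> {#}"
  obtains a where "a \<in># B" "\<forall>d \<in># B. d \<in> {a, a + 1}"
proof
  let ?a = "Min (set_mset B)"
  show "?a \<in># B" using assms(2) by simp
  then show "\<forall>d \<in># B. d \<in> {?a, ?a + 1}"
    using assms(1) unfolding balanced_def
    by (metis Min_le finite_set_mset insertCI le_add1 le_antisym le_Suc_eq Suc_eq_plus1)
qed

text \<open>The degrees of \<open>B\<close> are two consecutive numbers, where the chord is exact.
  The chord product for \<open>M\<close> is at most that for \<open>B\<close>, because the base
  exceeds 1 and the sum is no larger. A degree of \<open>M\<close> off these two numbers would push
  the product of \<open>M\<close> strictly below.\<close>

lemma balanced_optimal:
  assumes "balanced B" "B \<noteq> {#}" "\<forall>d \<in># B. 1 \<le> d"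
    and "size M = size B" "sum_mset M \<le> sum_mset B" "\<forall>d \<in># M. 1 \<le> d"
    and "prod_mset B \<le> prod_mset M"
  shows "balanced M"
proof -
  obtain a where a: "a \<in># B" "\<forall>d \<in># B. d \<in> {a, a + 1}" using balanced_range assms(1,2) by blast
  have a0: "0 < a" using a(1) assms(3) by force
  let ?q = "1 + 1 / real a"
  have q: "1 \<le> ?q" "0 < ?q" by (simp_all add: add_pos_nonneg)
  have "(\<Prod>d \<in># M. chord a d) \<le> (\<Prod>d \<in># B. chord a d)"
    unfolding prod_mset_chord assms(4) using q assms(5) by (intro mult_left_mono power_increasing) auto
  also have "\<dots> = real (prod_mset B)"
    unfolding prod_mset_of_nat using a(2) chord_eq[OF a0]
    by (intro arg_cong[where f = prod_mset] image_mset_cong) auto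
  also have "\<dots> \<le> real (prod_mset M)" using assms(7) by simp
  finally have le: "(\<Prod>d \<in># M. chord a d) \<le> (\<Prod>d \<in># M. real d)" unfolding prod_mset_of_nat .
  have "d \<in> {a, a + 1}" if "d \<in># M" for d
  proof (rule ccontr)
    assume d: "d \<notin> {a, a + 1}"
    obtain N where N: "M = add_mset d N" using multi_member_split[OF \<open>d \<in># M\<close>] by blast
    have N1: "\<forall>d \<in># N. 1 \<le> d" "1 \<le> d" using assms(6) N by auto
    have "(\<Prod>d \<in># M. real d) = real d * (\<Prod>d \<in># N. real d)" using N by simp
    also have "\<dots> < chord a d * (\<Prod>d \<in># N. real d)"
      using chord_greater[OF a0 N1(2) d] prod_chord_bounds(1)[OF a0 N1(1)] by simp
    also have "\<dots> \<le> chord a d * (\<Prod>d \<in># N. chord a d)"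
      using prod_chord_bounds(2)[OF a0 N1(1)] chord_ge[OF a0 N1(2)] by (intro mult_left_mono) auto
    also have "\<dots> = (\<Prod>d \<in># M. chord a d)" using N by simp
    finally show False using le by simp
  qed
  then show ?thesis unfolding balanced_def by (metis insertE le_add1 singletonD trans_le_add1 le_refl)
qed

section \<open>Degree multisets of competitors\<close>

lemma balanced_add1:
  assumes "balanced (add_mset d B)" "\<forall>x \<in># B. d \<le> x"
  shows "balanced (add_mset (d + 1) B)"
  using assms unfolding balanced_def by force

text \<open>Attaching pendant edges one by one, always at a vertex of least nonpendant degree, multiplies the
  product by \<open>3 / 2\<close> as long as there are vertices of degree 2, and levels the degrees afterwards.\<close>

lemma attach_pendants:
  assumes "cactus_degrees (B + replicate_mset k 1)" "B \<noteq> {#}" "\<forall>d \<in># B. 2 \<le> d"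
    and "set_mset B \<subseteq> {2, 3, 4} \<or> balanced B"
  shows "\<exists>B'. cactus_degrees (B' + replicate_mset (k + j) 1) \<and> size B' = size B \<and>
    sum_mset B' = sum_mset B + j \<and> (\<forall>d \<in># B'. 2 \<le> d) \<and>
    (set_mset B' \<subseteq> {2, 3, 4} \<and> real (prod_mset B') = real (prod_mset B) * (3 / 2) ^ j \<and> \<not> balanced B
      \<or> balanced B')"
proof (induction j)
  case 0
  then show ?case using assms by (intro exI[of _ B]) auto
next
  case (Suc j)
  then obtain B' where B': "cactus_degrees (B' + replicate_mset (k + j) 1)" "size B' = size B"
    "sum_mset B' = sum_mset B + j" "\<forall>d \<in># B'. 2 \<le> d"
    "set_mset B' \<subseteq> {2, 3, 4} \<and> real (prod_mset B') = real (prod_mset B) * (3 / 2) ^ j \<and> \<not> balanced B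
      \<or> balanced B'"
    by blast
  have ne: "B' \<noteq> {#}" using B'(2) assms(2) by auto
  define d where "d = Min (set_mset B')"
  have "d \<in># B'" using ne by (simp add: d_def)
  from multi_member_split[OF this] obtain R where R: "B' = add_mset d R" by blast
  have min: "d \<le> x" if "x \<in># B'" for x using that by (simp add: d_def)
  let ?B = "add_mset (d + 1) R"
  have "cactus_degrees (add_mset (d + 1) ((R + replicate_mset (k + j) 1) + {#1#}))"
    using B'(1) R by (intro cactus_degrees.add_edge) simp
  then have "cactus_degrees (?B + replicate_mset (k + Suc j) 1)" by (simp add: add_mset_commute)
  moreover have "size ?B = size B" "sum_mset ?B = sum_mset B + Suc j" "\<forall>x \<in># ?B. 2 \<le> x"
    using B'(2-4) R by auto
  moreover have "set_mset ?B \<subseteq> {2, 3, 4} \<and> real (prod_mset ?B) = real (prod_mset B) * (3 / 2) ^ Suc j \<and> \<not> balanced B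
      \<or> balanced ?B"
  proof (cases "balanced B'")
    case True
    then show ?thesis using balanced_add1 R min by auto
  next
    case False
    then have *: "set_mset B' \<subseteq> {2, 3, 4}" "real (prod_mset B') = real (prod_mset B) * (3 / 2) ^ j"
      "\<not> balanced B" using B'(5) by blast+
    \<comment> \<open>Degrees 3 and 4 alone are balanced, so an unbalanced multiset still contains a
      2. Raising it to 3 stays within the range and gives exactly the factor 3/2.\<close>
    have "d = 2"
    proof (rule ccontr)
      assume "d \<noteq> 2"
      then have "3 \<le> d" using B'(4) R by auto
      have range: "3 \<le> x \<and> x \<le> 4" if "x \<in># B'" for x
        using that *(1) \<open>3 \<le> d\<close> min[OF that] by auto
      have "balanced B'" unfolding balanced_def
      proof (intro ballI)
        fix x y assume "x \<in># B'" "y \<in># B'"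
        then show "x \<le> y + 1" using range[of x] range[of y] by linarith
      qed
      then show False using False by simp
    qed
    then show ?thesis using * R by auto
  qed
  ultimately show ?case by blast
qed

text \<open>\<open>j + 1\<close> triangles, each new one glued at a vertex of degree 2, so that no
  vertex lies on more than two of them.\<close>

lemma cactus_degrees_odd: "cactus_degrees (replicate_mset j 4 + replicate_mset (j + 3) 2)"
proof (induction j)
  case 0
  show ?case using cactus_degrees.triangle by (simp add: numeral_3_eq_3)
next
  case (Suc j)
  then have "cactus_degrees (add_mset 2 (replicate_mset j 4 + replicate_mset (j + 2) 2))"
    by (simp add: numeral_eq_Suc)
  from cactus_degrees.add_triangle[OF this] show ?case by (simp add: numeral_eq_Suc add_mset_commute)
qed

text \<open>The start is two triangles joined by a bridge, obtained by gluing a triangle at the end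
  of a pendant edge; further triangles go to vertices of degree 2.\<close>

lemma cactus_degrees_even:
  "cactus_degrees (replicate_mset j 4 + {#3, 3#} + replicate_mset (j + 4) 2)"
proof (induction j)
  case 0
  have "cactus_degrees {#3, 2, 2, 1#}"
    using cactus_degrees.add_edge[of 2 "{#2, 2#}"] cactus_degrees.triangle by (simp add: add_mset_commute)
  then have "cactus_degrees (add_mset 1 {#3, 2, 2#})" by (simp add: add_mset_commute)
  from cactus_degrees.add_triangle[OF this] show ?case
    by (simp add: numeral_eq_Suc add_mset_commute)
next
  case (Suc j)
  then have "cactus_degrees (add_mset 2 (replicate_mset j 4 + {#3, 3#} + replicate_mset (j + 3) 2))"
    by (simp add: numeral_eq_Suc)
  from cactus_degrees.add_triangle[OF this] show ?case by (simp add: numeral_eq_Suc add_mset_commute)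
qed

text \<open>A triangle with a path of two edges attached, the start for four nonpendant
  vertices.\<close>

lemma cactus_degrees_paw_tail: "cactus_degrees ({#3, 2, 2, 2#} + replicate_mset 1 1)"
proof -
  have "cactus_degrees {#3, 2, 2, 1#}"
    using cactus_degrees.add_edge[of 2 "{#2, 2#}"] cactus_degrees.triangle by (simp add: add_mset_commute)
  then have "cactus_degrees (add_mset 1 {#3, 2, 2#})" by (simp add: add_mset_commute)
  from cactus_degrees.add_edge[OF this] show ?thesis by (simp add: add_mset_commute flip: numeral_2_eq_2)
qed

text \<open>\<open>s\<close> is the number of triangles, and \<open>6 * s + k\<close> is the largest
  degree sum that \<open>sum_degree_nonpendant_le\<close> permits for this size. Thus a balanced
  outcome meets the premise on sums in \<open>balanced_optimal\<close>.\<close>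

lemma ex_good_degrees_odd:
  assumes "2 \<le> s"
  shows "\<exists>B. cactus_degrees (B + replicate_mset k 1) \<and> size B = 2 * s + 1 \<and> sum_mset B = 6 * s + k \<and>
    (\<forall>d \<in># B. 2 \<le> d) \<and> (real (prod_mset B) = 8 ^ s * (3 / 2) ^ k \<or> balanced B)"
proof -
  obtain j where j: "s = Suc j" using assms by (cases s) auto
  let ?B = "replicate_mset j 4 + replicate_mset (j + 3) (2::nat)"
  have "real (prod_mset ?B) = 8 ^ s"
    using j by (simp add: power_add flip: power_mult_distrib)
  moreover have "\<forall>d \<in># ?B. 2 \<le> d" "set_mset ?B \<subseteq> {2, 3, 4}" by auto
  moreover have "size ?B = 2 * s + 1" "sum_mset ?B = 6 * s" "?B \<noteq> {#}" using j by auto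
  moreover have "cactus_degrees (?B + replicate_mset 0 1)" using cactus_degrees_odd[of j] by simp
  ultimately obtain B where "cactus_degrees (B + replicate_mset (0 + k) 1)" "size B = 2 * s + 1"
    "sum_mset B = 6 * s + k" "\<forall>d \<in># B. 2 \<le> d"
    "real (prod_mset B) = 8 ^ s * (3 / 2) ^ k \<or> balanced B"
    using attach_pendants[of ?B 0 k] by (metis (no_types, lifting))
  then show ?thesis by auto
qed

text \<open>For \<open>s = 1\<close> the inner bridge ends in a vertex on no cycle, so the weight
  bound is missed; the degrees 3, 2, 2, 2 are balanced instead. The far end of that bridge is
  nonpendant only thanks to a pendant edge, whence \<open>1 \<le> k\<close>.\<close>

lemma ex_good_degrees_even:
  assumes "1 \<le> s" "1 \<le> k"
  shows "\<exists>B. cactus_degrees (B + replicate_mset k 1) \<and> size B = 2 * s + 2 \<and> sum_mset B = 6 * s + 2 + k \<and>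
    (\<forall>d \<in># B. 2 \<le> d) \<and> (2 \<le> s \<and> real (prod_mset B) = 8 ^ s * (9 / 4) * (3 / 2) ^ k \<or> balanced B)"
proof (cases "s = 1")
  case True
  \<comment> \<open>A balanced start rules out the first alternative of
    \<open>attach_pendants\<close>; one of the \<open>k\<close> pendant vertices is already
    present.\<close>
  have "balanced {#3, 2, 2, 2#}" by (auto simp: balanced_def)
  then obtain B where B: "cactus_degrees (B + replicate_mset (1 + (k - 1)) 1)" "size B = 4"
    "sum_mset B = 9 + (k - 1)" "\<forall>d \<in># B. 2 \<le> d" "balanced B"
    using attach_pendants[OF cactus_degrees_paw_tail, of "k - 1"] by auto
  then have "cactus_degrees (B + replicate_mset k 1)" "size B = 2 * s + 2" "sum_mset B = 6 * s + 2 + k"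
    using assms(2) True by auto
  with B show ?thesis by blast
next
  case False
  then obtain j where j: "s = Suc (Suc j)" using assms by (cases s; cases "s - 1") auto
  let ?B = "replicate_mset j 4 + {#3, 3#} + replicate_mset (j + 4) (2::nat)"
  have "real (prod_mset ?B) = 8 ^ s * (9 / 4)"
    using j by (simp add: power_add flip: power_mult_distrib)
  moreover have "\<forall>d \<in># ?B. 2 \<le> d" "set_mset ?B \<subseteq> {2, 3, 4}" by auto
  moreover have "size ?B = 2 * s + 2" "sum_mset ?B = 6 * s + 2" "?B \<noteq> {#}" using j by auto
  moreover have "cactus_degrees (?B + replicate_mset 0 1)" using cactus_degrees_even[of j] by simp
  ultimately obtain B where "cactus_degrees (B + replicate_mset (0 + k) 1)" "size B = 2 * s + 2"
    "sum_mset B = 6 * s + 2 + k" "\<forall>d \<in># B. 2 \<le> d"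
    "real (prod_mset B) = 8 ^ s * (9 / 4) * (3 / 2) ^ k \<or> balanced B"
    using attach_pendants[of ?B 0 k] by (metis (no_types, lifting))
  then show ?thesis using j by auto
qed

section \<open>Bounds and their equality case\<close>

lemma multiset_234:
  assumes "set_mset M \<subseteq> {2, 3, 4 :: nat}"
  obtains a b d where "M = replicate_mset a 4 + replicate_mset b 3 + replicate_mset d 2"
proof
  show "M = replicate_mset (count M 4) 4 + replicate_mset (count M 3) 3 + replicate_mset (count M 2) 2"
  proof (rule multiset_eqI)
    fix x
    show "count M x = count (replicate_mset (count M 4) 4 + replicate_mset (count M 3) 3 +
        replicate_mset (count M 2) 2) x"
      using assms by (cases "x \<in># M") (auto simp: not_in_iff)
  qed
qed

context big_cactus
begin

abbreviation "prod_degrees \<equiv> \<Prod>v \<in> nonpendant G. real (degree G v)"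

abbreviation "nonpendant_degrees \<equiv> image_mset (degree G) (mset_set (nonpendant G))"

text \<open>The equality case of the weight bound: \<open>s\<close> triangles, \<open>y\<close>
  inner edges, and at every nonpendant vertex one of the three types with exact weight.\<close>

definition tight :: "nat \<Rightarrow> nat \<Rightarrow> bool" where
  "tight s y \<longleftrightarrow> (\<forall>v \<in> nonpendant G. (cycle_degree G v, bridge_degree G v) \<in> {(1, 0), (1, 1), (2, 0)}) \<and>
     (\<forall>C \<in> cycles G. card (pverts C) \<le> 3) \<and> card (inner_bridges G) = 2 * y \<and> card (cycles G) = s"

lemma prod_degrees_verts: "(\<Prod>v \<in> pverts G. real (degree G v)) = prod_degrees"
proof -
  have "(\<Prod>v \<in> pverts G. real (degree G v)) = prod_degrees * (\<Prod>v \<in> pendant. real (degree G v))"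
    by (subst verts_split(1)) (rule prod.union_disjoint[OF finite_nonpendant finite_pendant verts_split(2)])
  also have "(\<Prod>v \<in> pendant. real (degree G v)) = 1" by (intro prod.neutral) simp
  finally show ?thesis by simp
qed

lemma prod_degrees_pos: "0 < prod_degrees"
  using degree_nonpendant by (intro prod_pos) fastforce

lemma zagreb1_eq: "zagreb1 c G = prod_degrees powr c"
proof -
  have "zagreb1 c G = (\<Prod>v \<in> pverts G. real (degree G v)) powr c"
    unfolding zagreb1_def by (rule prod_powr_distrib[symmetric])
  then show ?thesis by (simp add: prod_degrees_verts)
qed

lemma prod_degrees_le:
  "prod_degrees \<le> 2 ^ (\<Sum>C \<in> cycles G. card (pverts C)) * (3 / 2) ^ (k + card (inner_bridges G))"
  "2 ^ (\<Sum>C \<in> cycles G. card (pverts C)) * (3 / 2) ^ (k + card (inner_bridges G)) \<le> prod_degrees \<Longrightarrow>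
   \<forall>v \<in> nonpendant G. (cycle_degree G v, bridge_degree G v) \<in> {(1, 0), (1, 1), (2, 0)}"
proof -
  let ?w = "\<lambda>v. 2 ^ cycle_degree G v * (3 / 2 :: real) ^ bridge_degree G v"
  have w: "(\<Prod>v \<in> nonpendant G. ?w v) =
      2 ^ (\<Sum>C \<in> cycles G. card (pverts C)) * (3 / 2) ^ (k + card (inner_bridges G))"
    by (simp add: prod.distrib sum_cycle_degree_nonpendant sum_bridge_degree add.commute
        flip: power_sum)
  have le: "0 \<le> real (degree G v) \<and> real (degree G v) \<le> ?w v \<and> 0 < ?w v" for v
    using degree_weight_le[of "cycle_degree G v" "bridge_degree G v"] by (simp add: degree_split'[of v])
  show "prod_degrees \<le> 2 ^ (\<Sum>C \<in> cycles G. card (pverts C)) * (3 / 2) ^ (k + card (inner_bridges G))"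
    unfolding w[symmetric] using le by (intro prod_mono) blast
  assume "2 ^ (\<Sum>C \<in> cycles G. card (pverts C)) * (3 / 2) ^ (k + card (inner_bridges G)) \<le> prod_degrees"
  then have ge: "prod ?w (nonpendant G) \<le> prod_degrees" unfolding w .
  show "\<forall>v \<in> nonpendant G. (cycle_degree G v, bridge_degree G v) \<in> {(1, 0), (1, 1), (2, 0)}"
  proof (rule ballI, rule ccontr)
    fix v assume "v \<in> nonpendant G" "(cycle_degree G v, bridge_degree G v) \<notin> {(1, 0), (1, 1), (2, 0)}"
    then show False
      using prod_eq_imp_eq[OF finite_nonpendant le ge, of v] degree_weight_less
      by (simp only: degree_split'[of v]) (metis less_irrefl)
  qed
qed

lemma upper_bound_odd:
  assumes "card (nonpendant G) = 2 * s + 1"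
  shows "prod_degrees \<le> 8 ^ s * (3 / 2) ^ k" "8 ^ s * (3 / 2) ^ k \<le> prod_degrees \<Longrightarrow> tight s 0"
proof -
  obtain x y where xy: "(\<Sum>C \<in> cycles G. card (pverts C)) = 3 * card (cycles G) + x"
    "card (inner_bridges G) = 2 * y" "card (nonpendant G) = 1 + 2 * card (cycles G) + x + y"
    "x = 0 \<Longrightarrow> \<forall>C \<in> cycles G. card (pverts C) \<le> 3" using excess by blast
  note le = prod_degrees_le[unfolded xy(1,2)]
  have eq: "2 * card (cycles G) + x + y = 2 * s" using assms xy(3) by simp
  show "prod_degrees \<le> 8 ^ s * (3 / 2) ^ k" using le(1) weight_bound_odd(1)[OF eq, of k] by linarith
  assume *: "8 ^ s * (3 / 2) ^ k \<le> prod_degrees"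
  then have "x = 0 \<and> y = 0" using le(1) weight_bound_odd(2)[OF eq, of k] by linarith
  moreover have "2 ^ (3 * card (cycles G) + x) * (3 / 2) ^ (k + 2 * y) \<le> prod_degrees"
    using * weight_bound_odd(1)[OF eq, of k] by linarith
  ultimately show "tight s 0" using le(2) xy eq by (auto simp: tight_def)
qed

lemma upper_bound_even:
  assumes "card (nonpendant G) = 2 * s + 2"
  shows "prod_degrees \<le> 8 ^ s * (9 / 4) * (3 / 2) ^ k"
    "8 ^ s * (9 / 4) * (3 / 2) ^ k \<le> prod_degrees \<Longrightarrow> tight s 1"
proof -
  obtain x y where xy: "(\<Sum>C \<in> cycles G. card (pverts C)) = 3 * card (cycles G) + x"
    "card (inner_bridges G) = 2 * y" "card (nonpendant G) = 1 + 2 * card (cycles G) + x + y"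
    "x = 0 \<Longrightarrow> \<forall>C \<in> cycles G. card (pverts C) \<le> 3" using excess by blast
  note le = prod_degrees_le[unfolded xy(1,2)]
  have eq: "2 * card (cycles G) + x + y = 2 * s + 1" using assms xy(3) by simp
  show "prod_degrees \<le> 8 ^ s * (9 / 4) * (3 / 2) ^ k"
    using le(1) weight_bound_even(1)[OF eq, of k] by linarith
  assume *: "8 ^ s * (9 / 4) * (3 / 2) ^ k \<le> prod_degrees"
  then have "x = 0 \<and> y = 1" using le(1) weight_bound_even(2)[OF eq, of k] by linarith
  moreover have "2 ^ (3 * card (cycles G) + x) * (3 / 2) ^ (k + 2 * y) \<le> prod_degrees"
    using * weight_bound_even(1)[OF eq, of k] by linarith
  ultimately show "tight s 1" using le(2) xy eq by (auto simp: tight_def)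
qed

text \<open>The degree sum grows with the number of cycles, and by \<open>excess\<close> every cycle
  takes up two nonpendant vertices besides a single initial one.\<close>

lemma sum_degree_nonpendant_le:
  "sum (degree G) (nonpendant G) + 2 \<le> 2 * card (nonpendant G) + 2 * ((card (nonpendant G) - 1) div 2) + k"
proof -
  obtain x y where "card (nonpendant G) = 1 + 2 * card (cycles G) + x + y"
    by (rule excess) (rule that)
  then have "card (cycles G) \<le> (card (nonpendant G) - 1) div 2" by simp
  then show ?thesis using sum_degree_nonpendant card_nonpendant n_ge by linarith
qed

lemma nonpendant_degrees_props:
  "size nonpendant_degrees = card (nonpendant G)"
  "sum_mset nonpendant_degrees = sum (degree G) (nonpendant G)"
  "real (prod_mset nonpendant_degrees) = prod_degrees"
  "\<forall>d \<in># nonpendant_degrees. 2 \<le> d"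
  using degree_nonpendant finite_nonpendant
  by (auto simp: sum_unfold_sum_mset prod_unfold_prod_mset prod_mset_of_nat image_mset.compositionality comp_def)

section \<open>Structure in the equality case\<close>

lemma tight_degrees:
  assumes "tight s y" "v \<in> nonpendant G"
  shows "degree G v \<in> {2, 3, 4}" "1 \<le> cycle_degree G v" "bridge_degree G v = (if degree G v = 3 then 1 else 0)"
  using assms degree_split'[of v] unfolding tight_def by fastforce+

text \<open>In the tight case every nonpendant vertex lies on a cycle. The second vertex of a longer
  dense path is nonpendant, yet the path may meet cycles in its first vertex only. This is stronger
  than (ii), which tolerates one path of length 2.\<close>

lemma no_long_dense_path:
  assumes "tight s y" "dense_path G D p"
  shows "p \<le> 1"
proof (rule ccontr)
  assume "\<not> p \<le> 1"
  from assms(2)[unfolded dense_path_def] obtain us W where us: "length us = p" "W \<noteq> {}"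
    and W: "\<forall>v \<in> W. vpath (us @ [v]) (with_proj G) \<and> degree G v = 1 \<and>
        (\<forall>C \<in> cycles G. \<forall>C' \<in> cycles G.
           set (us @ [v]) \<inter> pverts C \<noteq> {} \<and> set (us @ [v]) \<inter> pverts C' \<noteq> {} \<longrightarrow> C = C') \<and>
        (\<forall>C \<in> cycles G. set (us @ [v]) \<inter> pverts C \<noteq> {} \<longrightarrow>
           set (us @ [v]) \<inter> pverts C = {hd us})"
    by (elim exE conjE) (rule that)
  obtain v where v: "v \<in> W" using us(2) by blast
  note W = W[rule_format, OF v]
  obtain u1 u2 rest where u: "us = u1 # u2 # rest"
    using us(1) \<open>\<not> p \<le> 1\<close> by (cases us; cases "tl us") auto
  \<comment> \<open>The successor of \<open>u2\<close> on the path, which is the pendant vertex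
    \<open>v\<close> if \<open>rest\<close> is empty.\<close>
  define z where "z = hd (rest @ [v])"
  have path: "distinct (us @ [v])" "set (vwalk_arcs (us @ [v])) \<subseteq> parcs G"
    using W by (auto simp: vpath_def vwalk_def)
  have arcs: "(u1, u2) \<in> parcs G" "(u2, z) \<in> parcs G"
    using path(2) unfolding u z_def by auto
  have "z \<in> set (rest @ [v])" unfolding z_def by (intro hd_in_set) simp
  then have "u1 \<noteq> z" using path(1) unfolding u by auto
  then have "degree G u2 \<noteq> 1"
    using degree_1_unique[of G u2 u1 z] arcs symD[OF pg(4) arcs(1)] by blast
  then have "u2 \<in> nonpendant G" using arcs pg(3) by (auto simp: nonpendant_def)
  then have "1 \<le> cycle_degree G u2" using tight_degrees(2)[OF assms(1)] by blast
  then have "{C \<in> cycles G. u2 \<in> pverts C} \<noteq> {}" unfolding cycle_degree_def by (metis card.empty not_one_le_zero)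
  then obtain C where C: "C \<in> cycles G" "u2 \<in> pverts C" by blast
  have "u2 \<in> set (us @ [v]) \<inter> pverts C" using C u by simp
  moreover from this have "set (us @ [v]) \<inter> pverts C = {hd us}" using W C(1) by blast
  ultimately have "u2 \<in> {hd us}" by metis
  then show False using path(1) u by simp
qed

text \<open>The path meets each cycle in at most one vertex, so none of its edges lies on a cycle.
  Its ends lie on cycles and its other vertices have two neighbours on the path, so none of them is
  pendant.\<close>

lemma two_cycle_path_arc:
  assumes xs: "vpath xs (with_proj G)" "C \<in> cycles G" "C' \<in> cycles G"
    "set xs \<inter> pverts C = {hd xs}" "set xs \<inter> pverts C' = {last xs}"
    "\<forall>C'' \<in> cycles G - {C, C'}. set xs \<inter> pverts C'' = {}"
    and ab: "(a, b) \<in> set (vwalk_arcs xs)"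
  shows "(a, b) \<in> inner_bridges G"
proof -
  have path: "distinct xs" "set (vwalk_arcs xs) \<subseteq> parcs G" "xs \<noteq> []"
    using xs(1) by (auto simp: vpath_def vwalk_def)
  have abG: "(a, b) \<in> parcs G" "a \<in> set xs" "b \<in> set xs" "a \<noteq> b"
    using ab path vwalk_arcs_in_set[OF ab] vwalk_arcs_neq[OF path(1) ab] by auto
  have "(a, b) \<notin> parcs F" if F: "F \<in> cycles G" for F
  proof
    assume "(a, b) \<in> parcs F"
    then have "a \<in> pverts F" "b \<in> pverts F" using pair_graph_arcD[OF cycles_props(1)[OF pair_graph F]] by auto
    then have "{a, b} \<subseteq> set xs \<inter> pverts F" using abG by auto
    moreover have "F = C \<or> F = C'" using calculation xs(6) F by blast
    ultimately have "{a, b} \<subseteq> {hd xs} \<or> {a, b} \<subseteq> {last xs}" using xs(4,5) by metis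
    then show False using abG(4) by auto
  qed
  then have br: "(a, b) \<in> bridges G" using abG(1) by (simp add: bridges_def)
  have on_cycle: "degree G v \<noteq> 1" if "F \<in> cycles G" "v \<in> pverts F" for v F
  proof -
    have "0 < card {C \<in> cycles G. v \<in> pverts C}"
      using that finite_cycles[OF pair_graph] by (auto simp: card_gt_0_iff)
    then show ?thesis using degree_split'[of v] by (simp add: cycle_degree_def)
  qed
  have ends: "degree G (hd xs) \<noteq> 1" "degree G (last xs) \<noteq> 1"
    using on_cycle xs(2-5) by blast+
  obtain ys zs where yz: "xs = ys @ zs" "ys \<noteq> []" "zs \<noteq> []" "last ys = a" "hd zs = b"
    using vwalk_arcs_split[OF ab] .
  have "degree G a \<noteq> 1"
  proof (cases "butlast ys = []")
    case True
    then have "ys = [a]" using yz(2,4) by (metis append_butlast_last_id append_Nil)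
    then show ?thesis using ends(1) yz(1) by simp
  next
    case False
    define a' where "a' = last (butlast ys)"
    have ys: "xs = butlast ys @ a # zs" using yz(1,2,4) by (metis append_butlast_last_id append_assoc append_Cons append_Nil)
    have "(a', a) \<in> set (vwalk_arcs xs)"
      unfolding ys a'_def using False by (subst vwalk_arcs_append) auto
    then have "(a, a') \<in> parcs G" using path(2) symD[OF pg(4)] by blast
    moreover have "a' \<in> set (butlast ys)" unfolding a'_def using False by (rule last_in_set)
    then have "a' \<noteq> b" using path(1) yz(3,5) unfolding ys by (metis IntI distinct_append empty_iff list.set_intros(2) list.set_sel(1))
    ultimately show ?thesis using degree_1_unique[of G a a' b] abG(1) by blast
  qed
  moreover have "degree G b \<noteq> 1"
  proof (cases "tl zs")
    case Nil
    then have "zs = [b]" using yz(3,5) by (cases zs) auto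
    then show ?thesis using ends(2) yz(1) by simp
  next
    case (Cons b' ws)
    then have zs: "zs = b # b' # ws" using yz(3,5) by (cases zs) auto
    have "(b, b') \<in> set (vwalk_arcs xs)"
      unfolding yz(1) zs using yz(2) by (subst vwalk_arcs_append) auto
    then have "(b, b') \<in> parcs G" using path(2) by blast
    moreover have "a \<noteq> b'" using path(1) last_in_set[OF yz(2)] yz(4) unfolding yz(1) zs by auto
    ultimately show ?thesis using degree_1_unique[of G b a b'] symD[OF pg(4) abG(1)] by blast
  qed
  ultimately show ?thesis using br abG(1) pg(3) by (auto simp: inner_bridges_def nonpendant_def)
qed

text \<open>All arcs of the path are inner bridges, of which there is at most one edge. Describing
  \<open>P\<close> through \<open>inner_bridges\<close> alone yields uniqueness at once.\<close>

lemma two_cycle_path_unique: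
  assumes "card (inner_bridges G) \<le> 2" "two_cycle_path G P l" "0 < l"
  shows "l = 1" "P = \<lparr>pverts = fst ` inner_bridges G, parcs = inner_bridges G\<rparr>"
proof -
  obtain xs C C' where xs: "vpath xs (with_proj G)" "C \<in> cycles G" "C' \<in> cycles G"
    "set xs \<inter> pverts C = {hd xs}" "set xs \<inter> pverts C' = {last xs}"
    "\<forall>C'' \<in> cycles G - {C, C'}. set xs \<inter> pverts C'' = {}"
    and P: "P = \<lparr>pverts = set xs, parcs = set (vwalk_arcs xs) \<union> (set (vwalk_arcs xs))\<inverse>\<rparr>"
    and l: "l = length xs - 1"
    using assms(2) unfolding two_cycle_path_def vwalk_length_simp by blast
  have dist: "distinct xs" using xs(1) by (simp add: vpath_def)
  have fin: "finite (inner_bridges G)"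
    using bridges_sub pg(2) by (auto simp: inner_bridges_def intro: finite_subset)
  have sym: "(b, a) \<in> inner_bridges G" if "(a, b) \<in> inner_bridges G" for a b
    using that sym_bridges by (auto simp: inner_bridges_def dest: symD)
  have sub: "set (vwalk_arcs xs) \<subseteq> inner_bridges G" using two_cycle_path_arc[OF xs] by auto
  obtain a b ws where ws: "xs = a # b # ws" using l assms(3) by (cases xs; cases "tl xs") auto
  have ab: "(a, b) \<in> inner_bridges G" "(b, a) \<in> inner_bridges G" "a \<noteq> b"
    using sub sym dist unfolding ws by auto
  have eq: "inner_bridges G = {(a, b), (b, a)}"
    using ab assms(1) fin by (intro card_seteq[symmetric]) auto
  have "ws = []"
  proof (cases ws)
    case (Cons d ds)
    then have "(b, d) \<in> inner_bridges G" using sub unfolding ws by auto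
    then show ?thesis using eq dist unfolding ws Cons by auto
  qed simp
  then have xs2: "xs = [a, b]" using ws by simp
  then show "l = 1" using l by simp
  show "P = \<lparr>pverts = fst ` inner_bridges G, parcs = inner_bridges G\<rparr>"
    unfolding P xs2 eq by auto
qed

lemma tight_structure:
  assumes "tight s y" "y \<le> 1"
  shows "(\<forall>u \<in> nonpendant G. degree G u \<in> {2, 3, 4}) \<and>
        (\<forall>C \<in> cycles G. card (pverts C) \<le> 3) \<and>
        (\<forall>D p. dense_path G D p \<and> p > 1 \<longrightarrow> p = 2) \<and>
        (\<exists>\<^sub>\<le>\<^sub>1 D. \<exists>p > 1. dense_path G D p) \<and>
        (\<forall>P l. two_cycle_path G P l \<and> l > 0 \<longrightarrow> l = 1) \<and>
        (\<exists>\<^sub>\<le>\<^sub>1 P. \<exists>l > 0. two_cycle_path G P l)"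
proof (intro conjI)
  have "card (inner_bridges G) \<le> 2" using assms by (simp add: tight_def)
  note path = two_cycle_path_unique[OF this]
  show "\<forall>P l. two_cycle_path G P l \<and> l > 0 \<longrightarrow> l = 1" using path(1) by blast
  show "\<exists>\<^sub>\<le>\<^sub>1 P. \<exists>l > 0. two_cycle_path G P l" using path(2) unfolding Uniq_def by metis
  \<comment> \<open>No dense path exceeds length 1, so both clauses on dense paths hold
    vacuously.\<close>
  note dense = no_long_dense_path[OF assms(1)]
  show "\<forall>D p. dense_path G D p \<and> p > 1 \<longrightarrow> p = 2" using dense by fastforce
  show "\<exists>\<^sub>\<le>\<^sub>1 D. \<exists>p > 1. dense_path G D p" using dense unfolding Uniq_def by (metis not_le)
qed (use assms(1) tight_degrees(1) in \<open>auto simp: tight_def\<close>)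

lemma balanced_difference:
  assumes "balanced nonpendant_degrees" "u \<in> nonpendant G" "v \<in> nonpendant G"
  shows "\<bar>int (degree G u) - int (degree G v)\<bar> \<le> 1"
proof -
  have "degree G u \<in># nonpendant_degrees" "degree G v \<in># nonpendant_degrees"
    using assms(2,3) finite_nonpendant by auto
  then have "degree G u \<le> degree G v + 1" "degree G v \<le> degree G u + 1"
    using assms(1) unfolding balanced_def by blast+
  then show ?thesis by linarith
qed

end

section \<open>The extremal cacti\<close>

lemma prod_mset_degree_sequence:
  "real (prod_mset (degree_sequence G)) = (\<Prod>v \<in> pverts G. real (degree G v))"
  unfolding degree_sequence_def prod_mset_of_nat prod_unfold_prod_mset
  by (simp add: image_mset.compositionality comp_def)

lemma count_degree_sequence:
  assumes "finite (pverts G)"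
  shows "count (degree_sequence G) d = card {v \<in> pverts G. degree G v = d}"
  using assms by (simp add: degree_sequence_def count_image_mset' eq_commute)

context big_cactus
begin

lemma competitor:
  assumes "0 < c" "\<forall>H \<in> (cacti n k :: 'a pair_pre_digraph set). zagreb1 c H \<le> zagreb1 c G"
    and "cactus_degrees (B + replicate_mset k 1)" "size B = card (nonpendant G)" "\<forall>d \<in># B. 2 \<le> d"
  shows "real (prod_mset B) \<le> prod_degrees"
proof -
  have "card (pverts G) = size (B + replicate_mset k 1)"
    using assms(4) card_nonpendant card_verts by simp
  then obtain H where H: "cactus H" "pverts H = pverts G" "degree_sequence H = B + replicate_mset k 1"
    using ex_cactus_with_degrees[OF assms(3) pg(1)] by blast
  \<comment> \<open>Hence the pendant vertices of \<open>H\<close> are exactly the \<open>k\<close>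
    appended ones.\<close>
  have "count B 1 = 0" using assms(5) by (metis not_in_iff not_less_eq_eq numeral_2_eq_2 One_nat_def le_refl)
  then have "card {v \<in> pverts H. degree H v = 1} = k"
    using count_degree_sequence[of H 1] H(2,3) pg(1) by simp
  then have "H \<in> cacti n k" using H(1,2) card_verts by (simp add: cacti_def)
  then have "zagreb1 c H \<le> zagreb1 c G" using assms(2) by blast
  moreover have "zagreb1 c H = real (prod_mset B) powr c"
    using prod_mset_degree_sequence[of H] H(3)
    by (simp add: zagreb1_def prod_powr_distrib[symmetric])
  ultimately have "real (prod_mset B) powr c \<le> prod_degrees powr c" using zagreb1_eq by simp
  then show ?thesis using assms(1) prod_degrees_pos
    by (metis linorder_not_le powr_less_mono2 less_imp_le)
qed

lemma maximal_balanced_or_tight: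
  assumes "0 < c" "\<forall>H \<in> (cacti n k :: 'a pair_pre_digraph set). zagreb1 c H \<le> zagreb1 c G" "4 \<le> card (nonpendant G)" "1 \<le> k"
  shows "balanced nonpendant_degrees \<or> (\<exists>s. tight s 0 \<or> tight s 1)"
proof -
  let ?N = "card (nonpendant G)"
  note comp = competitor[OF assms(1,2)]
  have opt: "balanced nonpendant_degrees"
    if B: "balanced B" "cactus_degrees (B + replicate_mset k 1)" "size B = ?N" "\<forall>d \<in># B. 2 \<le> d"
      "sum (degree G) (nonpendant G) \<le> sum_mset B" for B
  proof (rule balanced_optimal[OF B(1)])
    show "B \<noteq> {#}" using B(3) assms(3) by auto
    show "\<forall>d \<in># B. 1 \<le> d" "\<forall>d \<in># nonpendant_degrees. 1 \<le> d"
      using B(4) nonpendant_degrees_props(4) by fastforce+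
    show "prod_mset B \<le> prod_mset nonpendant_degrees"
      using comp[OF B(2,3,4)] nonpendant_degrees_props(3) by linarith
  qed (use B nonpendant_degrees_props in simp_all)
  note sum_le = sum_degree_nonpendant_le
  show ?thesis
  proof (cases "odd ?N")
    case True
    then obtain s where s: "?N = 2 * s + 1" by (elim oddE)
    then have "2 \<le> s" using assms(3) by simp
    from ex_good_degrees_odd[OF this, of k] obtain B where B: "cactus_degrees (B + replicate_mset k 1)"
      "size B = ?N" "sum_mset B = 6 * s + k" "\<forall>d \<in># B. 2 \<le> d"
      "real (prod_mset B) = 8 ^ s * (3 / 2) ^ k \<or> balanced B" unfolding s by blast
    from B(5) show ?thesis
    proof
      assume "real (prod_mset B) = 8 ^ s * (3 / 2) ^ k"
      then show ?thesis using comp[OF B(1,2,4)] upper_bound_odd(2)[OF s] by auto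
    next
      assume "balanced B"
      then show ?thesis using opt[OF _ B(1,2,4)] B(3) sum_le s by simp
    qed
  next
    case False
    then obtain m where "?N = 2 * m" by (auto elim: evenE)
    then obtain s where s: "?N = 2 * s + 2" "1 \<le> s" using assms(3) by (intro that[of "m - 1"]) auto
    from ex_good_degrees_even[OF s(2) assms(4)] obtain B where B: "cactus_degrees (B + replicate_mset k 1)"
      "size B = ?N" "sum_mset B = 6 * s + 2 + k" "\<forall>d \<in># B. 2 \<le> d"
      "real (prod_mset B) = 8 ^ s * (9 / 4) * (3 / 2) ^ k \<or> balanced B" unfolding s(1) by blast
    from B(5) show ?thesis
    proof
      assume "real (prod_mset B) = 8 ^ s * (9 / 4) * (3 / 2) ^ k"
      then show ?thesis using comp[OF B(1,2,4)] upper_bound_even(2)[OF s(1)] by auto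
    next
      assume "balanced B"
      moreover have "(2 * s + 1) div 2 = s" by simp
      ultimately show ?thesis using opt[OF _ B(1,2,4)] B(3) sum_le s(1) by simp
    qed
  qed
qed

section \<open>Cacti without pendant vertices\<close>

lemma nonpendant_eq_verts: "k = 0 \<Longrightarrow> nonpendant G = pverts G"
  using card_pendant finite_pendant by (auto simp: nonpendant_def)

lemma degree_sequence_eq: "k = 0 \<Longrightarrow> degree_sequence G = nonpendant_degrees"
  by (simp add: degree_sequence_def nonpendant_eq_verts)

lemma prod_degrees_eq: "k = 0 \<Longrightarrow> prod_degrees = real (prod_mset (degree_sequence G))"
  using prod_mset_degree_sequence[of G] nonpendant_eq_verts by simp

text \<open>Degree 3 occurs exactly at vertices with one bridge end, and for \<open>k = 0\<close>
  all bridges are inner, which gives \<open>2 * y\<close> such vertices. Size and degree sum then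
  provide two linear equations for the numbers of 4s and 2s.\<close>

lemma tight_degree_sequence:
  assumes "k = 0" "tight s y"
  obtains a d where "degree_sequence G = replicate_mset a 4 + replicate_mset (2 * y) 3 + replicate_mset d 2"
    "a + 2 * y + d = n" "4 * a + 6 * y + 2 * d = 2 * (n - 1) + 2 * s"
proof -
  note V = nonpendant_eq_verts[OF assms(1)]
  have "set_mset (degree_sequence G) \<subseteq> {2, 3, 4}"
    using tight_degrees(1)[OF assms(2)] V pg(1) by (auto simp: degree_sequence_def)
  then obtain a b d where abd: "degree_sequence G = replicate_mset a 4 + replicate_mset b 3 + replicate_mset d 2"
    by (rule multiset_234)
  have "b = card {v \<in> pverts G. degree G v = 3}"
    using count_degree_sequence[OF pg(1), of 3] by (simp add: abd)
  also have "\<dots> = sum (bridge_degree G) (nonpendant G)"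
    using tight_degrees(3)[OF assms(2)] V pg(1) by (simp add: sum.If_cases Int_def)
  also have "\<dots> = 2 * y" using sum_bridge_degree assms by (simp add: tight_def)
  finally have b: "b = 2 * y" .
  have "a + b + d = size (degree_sequence G)" by (simp add: abd)
  also have "\<dots> = n" using card_verts by (simp add: degree_sequence_def)
  finally have size: "a + b + d = n" .
  have "4 * a + 3 * b + 2 * d = sum_mset (degree_sequence G)" by (simp add: abd)
  also have "\<dots> = 2 * (n - 1) + 2 * s"
    using nonpendant_degrees_props(2) degree_sequence_eq sum_degree_nonpendant assms by (simp add: tight_def)
  finally have "4 * a + 3 * b + 2 * d = 2 * (n - 1) + 2 * s" .
  then show thesis using that[of a d] abd b size by simp
qed

lemma zagreb1_le_iff:
  assumes "0 < c" "0 < X" "prod_degrees \<le> X"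
  shows "zagreb1 c G \<le> X powr c" "zagreb1 c G = X powr c \<longleftrightarrow> prod_degrees = X"
proof -
  show "zagreb1 c G \<le> X powr c"
    unfolding zagreb1_eq using assms prod_degrees_pos by (intro powr_mono2) auto
  have "zagreb1 c G < X powr c" if "prod_degrees < X"
    unfolding zagreb1_eq using assms that prod_degrees_pos by (intro powr_less_mono2) auto
  then show "zagreb1 c G = X powr c \<longleftrightarrow> prod_degrees = X"
    using assms(3) zagreb1_eq by fastforce
qed

text \<open>For four vertices \<open>upper_bound_even\<close> would give only 18. Instead, at most
  one cycle fits, so the degree sum is at most 8 and every degree equals 2; both sides of the
  claimed equivalence are then always true.\<close>

lemma no_pendant_4:
  assumes "k = 0" "n = 4"
  shows "degree_sequence G = replicate_mset 4 2" "prod_degrees = 16"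
proof -
  have N: "card (nonpendant G) = 4" using card_nonpendant assms by simp
  have le: "sum (degree G) (nonpendant G) \<le> 8" using sum_degree_nonpendant_le N assms(1) by simp
  have "(\<Sum>v \<in> nonpendant G. degree G v) = (\<Sum>v \<in> nonpendant G. 2 + (degree G v - 2))"
    using degree_nonpendant by (intro sum.cong refl) (metis le_add_diff_inverse)
  also have "\<dots> = 8 + (\<Sum>v \<in> nonpendant G. degree G v - 2)" unfolding sum.distrib using N by simp
  finally have "(\<Sum>v \<in> nonpendant G. degree G v - 2) = 0" using le by simp
  then have "degree G v = 2" if "v \<in> nonpendant G" for v
    using that degree_nonpendant[OF that] finite_nonpendant by force
  then have "nonpendant_degrees = image_mset (\<lambda>_. 2) (mset_set (nonpendant G))"
    using finite_nonpendant by (intro image_mset_cong) auto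
  then show seq: "degree_sequence G = replicate_mset 4 2"
    using degree_sequence_eq[OF assms(1)] N by (simp add: image_mset_const_eq)
  show "prod_degrees = 16" using prod_degrees_eq[OF assms(1)] unfolding seq by simp
qed

lemma no_pendant_odd:
  assumes "k = 0" "n = 2 * t + 5"
  shows "prod_degrees \<le> 2 ^ (3 * t + 6)"
    "prod_degrees = 2 ^ (3 * t + 6) \<longleftrightarrow>
      degree_sequence G = replicate_mset (t + 1) 4 + replicate_mset (t + 4) 2"
proof -
  \<comment> \<open>An extremal cactus has \<open>t + 2\<close> triangles, which explains the offset
    between \<open>s\<close> and \<open>t\<close>.\<close>
  have N: "card (nonpendant G) = 2 * (t + 2) + 1" using card_nonpendant assms by simp
  have pow: "2 ^ (3 * t + 6) = (8 :: real) ^ (t + 2)" by (simp add: power_add power_mult)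
  note bound = upper_bound_odd[OF N, unfolded assms(1) power_0 mult_1_right]
  show "prod_degrees \<le> 2 ^ (3 * t + 6)" unfolding pow using bound(1) .
  show "prod_degrees = 2 ^ (3 * t + 6) \<longleftrightarrow>
      degree_sequence G = replicate_mset (t + 1) 4 + replicate_mset (t + 4) 2"
  proof
    assume "prod_degrees = 2 ^ (3 * t + 6)"
    then have "tight (t + 2) 0" using bound(2) pow by simp
    from tight_degree_sequence[OF assms(1) this] obtain a d where
      "degree_sequence G = replicate_mset a 4 + replicate_mset d 2" "a + d = n"
      "4 * a + 2 * d = 2 * (n - 1) + 2 * (t + 2)" by auto
    moreover from this(2,3) have "a = t + 1" "d = t + 4" using assms(2) by simp_all
    ultimately show "degree_sequence G = replicate_mset (t + 1) 4 + replicate_mset (t + 4) 2" by simp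
  next
    assume "degree_sequence G = replicate_mset (t + 1) 4 + replicate_mset (t + 4) 2"
    then have "prod_degrees = 4 ^ (t + 1) * 2 ^ (t + 4)" using prod_degrees_eq[OF assms(1)] by simp
    also have "\<dots> = 8 ^ (t + 2)" by (simp add: power_add flip: power_mult_distrib)
    finally show "prod_degrees = 2 ^ (3 * t + 6)" unfolding pow .
  qed
qed

lemma no_pendant_even:
  assumes "k = 0" "n = 2 * (t + 3)"
  shows "prod_degrees \<le> 2 ^ (3 * t + 4) * 9"
    "prod_degrees = 2 ^ (3 * t + 4) * 9 \<longleftrightarrow>
      degree_sequence G = replicate_mset t 4 + replicate_mset 2 3 + replicate_mset (t + 4) 2"
proof -
  have N: "card (nonpendant G) = 2 * (t + 2) + 2" using card_nonpendant assms by simp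
  have pow: "2 ^ (3 * t + 4) * 9 = (8 :: real) ^ (t + 2) * (9 / 4)" by (simp add: power_add power_mult)
  note bound = upper_bound_even[OF N, unfolded assms(1) power_0 mult_1_right]
  show "prod_degrees \<le> 2 ^ (3 * t + 4) * 9" unfolding pow using bound(1) .
  show "prod_degrees = 2 ^ (3 * t + 4) * 9 \<longleftrightarrow>
      degree_sequence G = replicate_mset t 4 + replicate_mset 2 3 + replicate_mset (t + 4) 2"
  proof
    assume "prod_degrees = 2 ^ (3 * t + 4) * 9"
    then have "tight (t + 2) 1" using bound(2) pow by simp
    from tight_degree_sequence[OF assms(1) this] obtain a d where
      "degree_sequence G = replicate_mset a 4 + replicate_mset 2 3 + replicate_mset d 2" "a + 2 + d = n"
      "4 * a + 6 + 2 * d = 2 * (n - 1) + 2 * (t + 2)" by auto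
    moreover from this(2,3) have "a = t" "d = t + 4" using assms(2) by simp_all
    ultimately show "degree_sequence G = replicate_mset t 4 + replicate_mset 2 3 + replicate_mset (t + 4) 2"
      by simp
  next
    assume "degree_sequence G = replicate_mset t 4 + replicate_mset 2 3 + replicate_mset (t + 4) 2"
    then have "prod_degrees = 4 ^ t * 9 * 2 ^ (t + 4)"
      using prod_degrees_eq[OF assms(1)] by (simp add: power2_eq_square)
    also have "\<dots> = 8 ^ (t + 2) * (9 / 4)" by (simp add: power_add flip: power_mult_distrib)
    finally show "prod_degrees = 2 ^ (3 * t + 4) * 9" unfolding pow .
  qed
qed

end

theorem theorem3:
  fixes c :: real and n k :: nat and G :: "'a pair_pre_digraph"
  assumes "c > 0" and "n \<ge> k + 4" and "G \<in> cacti n k"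
  shows
    "(k = 0 \<longrightarrow>
       (n = 4 \<longrightarrow>
          zagreb1 c G \<le> 16 powr c \<and>
          (zagreb1 c G = 16 powr c \<longleftrightarrow> degree_sequence G = replicate_mset 4 2)) \<and>
       (\<forall>t::nat. n = 2 * t + 5 \<longrightarrow>
          zagreb1 c G \<le> 2 powr ((3 * real t + 6) * c) \<and>
          (zagreb1 c G = 2 powr ((3 * real t + 6) * c) \<longleftrightarrow>
             degree_sequence G = replicate_mset (t + 1) 4 + replicate_mset (t + 4) 2)) \<and>
       (\<forall>t::nat. n = 2 * (t + 3) \<longrightarrow>
          zagreb1 c G \<le> 2 powr ((3 * real t + 4) * c) * 9 powr c \<and>
          (zagreb1 c G = 2 powr ((3 * real t + 4) * c) * 9 powr c \<longleftrightarrow>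
             degree_sequence G =
               replicate_mset t 4 + replicate_mset 2 3 + replicate_mset (t + 4) 2))) \<and>
     (k \<noteq> 0 \<and> (\<forall>H \<in> (cacti n k :: 'a pair_pre_digraph set). zagreb1 c H \<le> zagreb1 c G) \<longrightarrow>
       (\<forall>u \<in> nonpendant G. \<forall>v \<in> nonpendant G. \<bar>int (degree G u) - int (degree G v)\<bar> \<le> 1) \<or>
       ((\<forall>u \<in> nonpendant G. degree G u \<in> {2, 3, 4}) \<and>
        (\<forall>C \<in> cycles G. card (pverts C) \<le> 3) \<and>
        (\<forall>D p. dense_path G D p \<and> p > 1 \<longrightarrow> p = 2) \<and>
        (\<exists>\<^sub>\<le>\<^sub>1 D. \<exists>p > 1. dense_path G D p) \<and>
        (\<forall>P l. two_cycle_path G P l \<and> l > 0 \<longrightarrow> l = 1) \<and>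
        (\<exists>\<^sub>\<le>\<^sub>1 P. \<exists>l > 0. two_cycle_path G P l)))"
proof -
  interpret big_cactus G n k
    using assms(2,3) by unfold_locales (auto simp: cacti_def)
  have pow: "2 powr (real m * c) = (2 ^ m) powr c" for m
    by (simp add: powr_powr[symmetric] powr_realpow)
  show ?thesis
  proof (intro conjI impI allI)
    assume "k = 0" "n = 4"
    note * = no_pendant_4[OF this]
    show "zagreb1 c G \<le> 16 powr c"
      "zagreb1 c G = 16 powr c \<longleftrightarrow> degree_sequence G = replicate_mset 4 2"
      using * zagreb1_eq by simp_all
  next
    fix t assume "k = 0" "n = 2 * t + 5"
    note * = no_pendant_odd[OF this]
    have eq: "2 powr ((3 * real t + 6) * c) = (2 ^ (3 * t + 6)) powr c" using pow[of "3 * t + 6"] by simp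
    show "zagreb1 c G \<le> 2 powr ((3 * real t + 6) * c)"
      "zagreb1 c G = 2 powr ((3 * real t + 6) * c) \<longleftrightarrow>
         degree_sequence G = replicate_mset (t + 1) 4 + replicate_mset (t + 4) 2"
      unfolding eq using zagreb1_le_iff[OF assms(1) _ *(1)] *(2) by simp_all
  next
    fix t assume "k = 0" "n = 2 * (t + 3)"
    note * = no_pendant_even[OF this]
    have eq: "2 powr ((3 * real t + 4) * c) * 9 powr c = (2 ^ (3 * t + 4) * 9) powr c"
      using pow[of "3 * t + 4"] by (simp add: powr_mult)
    show "zagreb1 c G \<le> 2 powr ((3 * real t + 4) * c) * 9 powr c"
      "zagreb1 c G = 2 powr ((3 * real t + 4) * c) * 9 powr c \<longleftrightarrow>
         degree_sequence G = replicate_mset t 4 + replicate_mset 2 3 + replicate_mset (t + 4) 2"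
      unfolding eq using zagreb1_le_iff[OF assms(1) _ *(1)] *(2) by simp_all
  next
    assume k: "k \<noteq> 0 \<and> (\<forall>H \<in> (cacti n k :: 'a pair_pre_digraph set). zagreb1 c H \<le> zagreb1 c G)"
    have "4 \<le> card (nonpendant G)" using card_nonpendant assms(2) by simp
    then have "balanced nonpendant_degrees \<or> (\<exists>s. tight s 0 \<or> tight s 1)"
      using maximal_balanced_or_tight[OF assms(1)] k by simp
    then show "(\<forall>u \<in> nonpendant G. \<forall>v \<in> nonpendant G. \<bar>int (degree G u) - int (degree G v)\<bar> \<le> 1) \<or>
       ((\<forall>u \<in> nonpendant G. degree G u \<in> {2, 3, 4}) \<and>
        (\<forall>C \<in> cycles G. card (pverts C) \<le> 3) \<and>
        (\<forall>D p. dense_path G D p \<and> p > 1 \<longrightarrow> p = 2) \<and>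
        (\<exists>\<^sub>\<le>\<^sub>1 D. \<exists>p > 1. dense_path G D p) \<and>
        (\<forall>P l. two_cycle_path G P l \<and> l > 0 \<longrightarrow> l = 1) \<and>
        (\<exists>\<^sub>\<le>\<^sub>1 P. \<exists>l > 0. two_cycle_path G P l))"
    proof
      assume "balanced nonpendant_degrees"
      then show ?thesis by (intro disjI1 ballI balanced_difference)
    next
      assume "\<exists>s. tight s 0 \<or> tight s 1"
      then obtain s y where "tight s y" "y \<le> 1" by auto
      then show ?thesis by (intro disjI2 tight_structure)
    qed
  qed
qed

thm_deps theorem3

end
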